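(* Consider the Gaussian sequential learning model with smooth randomized response described in the context, where each agent's privacy budget $\varepsilon_n$ is drawn independently from a distribution $G$ supported on $[0,a]$ (for some $a>0$) with $G(\{0\})=0$. Then the convergence rate of the public log-likelihood ratio is upper bounded by order $\Theta(\sqrt n)$ and lower bounded by order $\Theta(\log n)$: conditional on $\theta=+1$, almost surely $l_n=O(\sqrt n)$ and $l_n=\Omega(\log n)$ as $n\to\infty$.
   Context: Gaussian model: unknown state $\theta\in\{-1,+1\}$ with uniform prior; agents $n=1,2,\dots$ act in sequence; agent $n$ privately observes $s_n\sim\mathcal{N}(\theta,\sigma^2)$, i.i.d. given $\theta$, $\sigma>0$, and has a private budget $\varepsilon_n\sim G$, independent across agents and of everything else. The public log-likelihood ratio is $l_n=\log\frac{\mathbb{P}(\theta=+1\mid x_1,\dots,x_{n-1})}{\mathbb{P}(\theta=-1\mid x_1,\dots,x_{n-1})}$, $l_1=0$, where $x_i$ are reported actions. With $t(l)=-\sigma^2l/2$, agent $n$'s intended action is $a_n=+1$ if $s_n>t(l_n)$, else $-1$; she reports $x_n=a_n$ with probability $1-u_n$ and $x_n=-a_n$ with probability $u_n=\frac12e^{-\varepsilon_n|s_n-t(l_n)|}$. The public, not observing $\varepsilon_n$, updates $l_{n+1}=l_n+\log\frac{\mathbb{P}(x_n\mid l_n,\theta=+1)}{\mathbb{P}(x_n\mid l_n,\theta=-1)}$, where these probabilities average over $s_n$ and $\varepsilon_n$. *)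

theory Defs
  imports "HOL-Probability.Probability"
begin

definition thr :: "real \<Rightarrow> real \<Rightarrow> real" where
  "thr \<sigma> l = - (\<sigma>\<^sup>2 * l) / 2"

definition flip_prob :: "real \<Rightarrow> real \<Rightarrow> real \<Rightarrow> real" where
  "flip_prob \<epsilon> s t = exp (- \<epsilon> * \<bar>s - t\<bar>) / 2"

definition intended :: "real \<Rightarrow> real \<Rightarrow> real \<Rightarrow> real" where
  "intended \<sigma> l s = (if s > thr \<sigma> l then 1 else -1)"

text \<open>Reported action: the agent flips her intended action iff the auxiliary
  uniform [0,1] variable v is below the flip probability (so flipping happens
  with probability u, independently of everything else).\<close>
definition reported :: "real \<Rightarrow> real \<Rightarrow> real \<Rightarrow> real \<Rightarrow> real \<Rightarrow> real" where
  "reported \<sigma> l s \<epsilon> v =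
     (if v < flip_prob \<epsilon> s (thr \<sigma> l) then - intended \<sigma> l s else intended \<sigma> l s)"

definition prob_plus :: "real measure \<Rightarrow> real \<Rightarrow> real \<Rightarrow> real \<Rightarrow> real" where
  "prob_plus G \<sigma> \<theta> l =
     (LINT s|lborel. normal_density \<theta> \<sigma> s *
        (LINT \<epsilon>|G. (if s > thr \<sigma> l then 1 - flip_prob \<epsilon> s (thr \<sigma> l)
                                  else flip_prob \<epsilon> s (thr \<sigma> l))))"

definition prob_action :: "real measure \<Rightarrow> real \<Rightarrow> real \<Rightarrow> real \<Rightarrow> real \<Rightarrow> real" where
  "prob_action G \<sigma> \<theta> l x = (if x = 1 then prob_plus G \<sigma> \<theta> l else 1 - prob_plus G \<sigma> \<theta> l)"

definition llr_update :: "real measure \<Rightarrow> real \<Rightarrow> real \<Rightarrow> real \<Rightarrow> real" where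
  "llr_update G \<sigma> l x = l + ln (prob_action G \<sigma> 1 l x / prob_action G \<sigma> (-1) l x)"

text \<open>Public LLR process. Agents are indexed from 0: public_llr 0 = l_1 = 0 and
  public_llr (Suc n) = l_{n+2} is obtained from l_{n+1} and the report of agent n
  (whose signal, budget and randomization variable are S n, E n, V n).\<close>
fun public_llr :: "real measure \<Rightarrow> real \<Rightarrow> (nat \<Rightarrow> 'a \<Rightarrow> real) \<Rightarrow> (nat \<Rightarrow> 'a \<Rightarrow> real)
                    \<Rightarrow> (nat \<Rightarrow> 'a \<Rightarrow> real) \<Rightarrow> nat \<Rightarrow> 'a \<Rightarrow> real" where
  "public_llr G \<sigma> S E V 0 \<omega> = 0"
| "public_llr G \<sigma> S E V (Suc n) \<omega> =
     llr_update G \<sigma> (public_llr G \<sigma> S E V n \<omega>)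
       (reported \<sigma> (public_llr G \<sigma> S E V n \<omega>) (S n \<omega>) (E n \<omega>) (V n \<omega>))"

end

theory Submission
  imports Defs
begin

text \<open>A report \<open>+1\<close> has probability \<open>report_prob \<epsilon> t s\<close> given the signal, which increases in \<open>s\<close>; the
  probabilities under the two states are its means at \<open>s = z \<plusminus> 1\<close> with centred noise \<open>z\<close>.
  Comparing pointwise in \<open>(z, \<epsilon>)\<close> shows that they differ by at least a multiple of
  \<open>exp (- k * \<bar>l\<bar>)\<close>, and that one report raises the public log-likelihood ratio \<open>l\<close> by at most
  \<open>C / l\<close> when \<open>l \<ge> 1\<close> (since \<open>\<epsilon> * exp (- \<epsilon> * y) \<le> 1 / y\<close>), and by a bounded amount otherwise.
  Hence \<open>l\<^sup>2\<close> grows at most linearly along every path.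

  For the lower bound, \<open>Y = exp (- l / 2)\<close> is a nonnegative supermartingale whose drift is governed
  by the Hellinger distance of the two report laws, and \<open>Y\<^sup>2\<close> is a martingale of mean 1. Together
  they give \<open>m (n + 1) \<le> m n * (1 - \<delta> * m n powr K)\<close> for \<open>m n = E (Y n)\<close>, so \<open>m n\<close> decays
  polynomially. Doob's maximal inequality on dyadic blocks and Borel--Cantelli then make \<open>Y\<close> decay
  polynomially almost surely. Wrong reports may occur infinitely often, so there is no shortcut
  through the path on which all reports are eventually correct.\<close>

section \<open>Pointwise bounds on the report probability\<close>

definition report_prob :: "real \<Rightarrow> real \<Rightarrow> real \<Rightarrow> real" where
  "report_prob \<epsilon> t s = (if s > t then 1 - flip_prob \<epsilon> s t else flip_prob \<epsilon> s t)"

lemma flip_prob_bounds: "0 < flip_prob \<epsilon> s t" "0 \<le> \<epsilon> \<Longrightarrow> flip_prob \<epsilon> s t \<le> 1 / 2"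
  by (auto simp: flip_prob_def)

lemma report_prob_bounds:
  assumes "0 \<le> \<epsilon>"
  shows "0 < report_prob \<epsilon> t s" "report_prob \<epsilon> t s < 1"
  using flip_prob_bounds[of \<epsilon> s t] assms by (auto simp: report_prob_def)

text \<open>If both signals lie on one side of \<open>t\<close>, the difference is half the drop of
  \<open>exp (- \<epsilon> * y)\<close> over a distance 2, with \<open>y\<close> the smaller
  distance to \<open>t\<close>; otherwise \<open>t\<close> separates them. The bound is a product of
  factors in \<open>\<epsilon>\<close>, \<open>z\<close> and \<open>t\<close>, so the factor in
  \<open>t\<close> can later leave the integral.\<close>

lemma report_prob_diff_ge:
  assumes \<epsilon>: "0 \<le> \<epsilon>" "\<epsilon> \<le> a"
  shows "report_prob \<epsilon> t (z + 1) - report_prob \<epsilon> t (z - 1)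
           \<ge> (1 - exp (- \<epsilon>)) / 2 * exp (- a * (1 + \<bar>z\<bar> + \<bar>t\<bar>))"
proof -
  have e1: "0 \<le> 1 - exp (- \<epsilon>)" using \<epsilon> by simp
  have step: "(1 - exp (- \<epsilon>)) * exp (- a * (1 + \<bar>z\<bar> + \<bar>t\<bar>)) \<le> exp (- \<epsilon> * y) - exp (- \<epsilon> * (y + 2))"
    if y: "0 \<le> y" "y \<le> 1 + \<bar>z\<bar> + \<bar>t\<bar>" for y
  proof -
    have "\<epsilon> * y \<le> a * (1 + \<bar>z\<bar> + \<bar>t\<bar>)" using \<epsilon> y by (intro mult_mono) auto
    then have "exp (- a * (1 + \<bar>z\<bar> + \<bar>t\<bar>)) \<le> exp (- \<epsilon> * y)" by simp
    then have "(1 - exp (- \<epsilon>)) * exp (- a * (1 + \<bar>z\<bar> + \<bar>t\<bar>)) \<le> (1 - exp (- 2 * \<epsilon>)) * exp (- \<epsilon> * y)"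
      using \<epsilon> by (intro mult_mono) auto
    also have "\<dots> = exp (- \<epsilon> * y) - exp (- \<epsilon> * (y + 2))"
      by (simp add: algebra_simps flip: exp_add)
    finally show ?thesis .
  qed
  consider "z - 1 > t" | "z + 1 \<le> t" | "z - 1 \<le> t" "t < z + 1" by linarith
  then show ?thesis
  proof cases
    case 1
    then show ?thesis using step[of "z - 1 - t"]
      by (simp add: report_prob_def flip_prob_def add.commute)
        (simp add: algebra_simps)
  next
    case 2
    then have "\<bar>z + 1 - t\<bar> = t - z - 1" "\<bar>z - 1 - t\<bar> = t - z - 1 + 2" by auto
    then show ?thesis using 2 step[of "t - z - 1"]
      by (simp add: report_prob_def flip_prob_def) (simp add: algebra_simps)
  next
    case 3
    \<comment> \<open>The distances of the two signals from \<open>t\<close> add up to 2, so one of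
      them is at least 1.\<close>
    have mix: "exp (- \<epsilon> * u) + exp (- \<epsilon> * v) \<le> 1 + exp (- \<epsilon>)" if "u \<ge> 0" "v \<ge> 1" for u v
    proof -
      have "\<epsilon> * 1 \<le> \<epsilon> * v" using that \<epsilon> by (intro mult_left_mono) auto
      then have "exp (- \<epsilon> * v) \<le> exp (- \<epsilon>)" by simp
      moreover have "exp (- \<epsilon> * u) \<le> 1" using that \<epsilon> by simp
      ultimately show ?thesis by linarith
    qed
    have "exp (- \<epsilon> * (z + 1 - t)) + exp (- \<epsilon> * (t - (z - 1))) \<le> 1 + exp (- \<epsilon>)"
      using mix[of "z + 1 - t" "t - (z - 1)"] mix[of "t - (z - 1)" "z + 1 - t"] 3 by linarith
    moreover have "(1 - exp (- \<epsilon>)) * exp (- a * (1 + \<bar>z\<bar> + \<bar>t\<bar>)) \<le> (1 - exp (- \<epsilon>)) * 1"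
      using \<epsilon> e1 by (intro mult_left_mono) auto
    moreover have "\<bar>z + 1 - t\<bar> = z + 1 - t" "\<bar>z - 1 - t\<bar> = t - (z - 1)" using 3 by auto
    ultimately show ?thesis using 3
      by (simp add: report_prob_def flip_prob_def)
  qed
qed

text \<open>If the lower signal exceeds \<open>t / 2\<close>, its distance \<open>y\<close> from
  \<open>t\<close> is more than \<open>\<bar>t\<bar> / 2\<close>, and
  \<open>\<epsilon> * exp (- \<epsilon> * y) \<le> 1 / y\<close> gives a bound uniform in
  \<open>\<epsilon>\<close>. Otherwise \<open>1 + \<bar>z\<bar> \<ge> \<bar>t\<bar> / 2\<close>, so
  the right-hand side is at least the trivial bound 1.\<close>

lemma report_prob_diff_le:
  assumes \<epsilon>: "0 \<le> \<epsilon>" and t: "t < 0"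
  shows "report_prob \<epsilon> t (z + 1) - report_prob \<epsilon> t (z - 1) \<le> 2 * (1 + \<bar>z\<bar>) / \<bar>t\<bar>"
proof (cases "z - 1 > t / 2")
  case True
  define y where "y = z - 1 - t"
  have y: "y > - t / 2" "y > 0" using True t by (auto simp: y_def)
  have "report_prob \<epsilon> t (z + 1) - report_prob \<epsilon> t (z - 1) = (exp (- \<epsilon> * y) - exp (- \<epsilon> * (y + 2))) / 2"
    using True t by (simp add: report_prob_def flip_prob_def y_def field_simps)
  also have "\<dots> = exp (- \<epsilon> * y) * (1 - exp (- 2 * \<epsilon>)) / 2"
    by (simp add: algebra_simps flip: exp_add)
  also have "\<dots> \<le> exp (- \<epsilon> * y) * (2 * \<epsilon>) / 2"
    using exp_ge_add_one_self[of "- 2 * \<epsilon>"] by (intro divide_right_mono mult_left_mono) auto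
  also have "\<dots> \<le> 1 / y"
  proof -
    have "\<epsilon> * y \<le> exp (\<epsilon> * y)" using exp_ge_add_one_self[of "\<epsilon> * y"] by linarith
    then show ?thesis using y by (simp add: field_simps exp_minus)
  qed
  also have "\<dots> \<le> 2 / \<bar>t\<bar>" using y t by (simp add: field_simps)
  also have "\<dots> \<le> 2 * (1 + \<bar>z\<bar>) / \<bar>t\<bar>" by (intro divide_right_mono) auto
  finally show ?thesis .
next
  case False
  have "report_prob \<epsilon> t (z + 1) - report_prob \<epsilon> t (z - 1) \<le> 1"
    using report_prob_bounds[OF \<epsilon>, of t "z + 1"] report_prob_bounds[OF \<epsilon>, of t "z - 1"] by linarith
  also have "1 \<le> 2 * (1 + \<bar>z\<bar>) / \<bar>t\<bar>" using False t by (simp add: field_simps)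
  finally show ?thesis .
qed

text \<open>Below the threshold, moving the signal by 2 changes the exponent by at most
  \<open>2 * a\<close>. The factor 2 covers the cases in which the higher signal exceeds
  \<open>t\<close> and its probability is estimated by 1.\<close>

lemma report_prob_ratio_le:
  assumes \<epsilon>: "0 \<le> \<epsilon>" "\<epsilon> \<le> a"
  shows "report_prob \<epsilon> t (z + 1) \<le> 2 * exp (2 * a) * report_prob \<epsilon> t (z - 1)"
proof -
  have ea: "exp (2 * \<epsilon>) \<le> 2 * exp (2 * a)"
  proof -
    have "exp (2 * \<epsilon>) \<le> exp (2 * a)" using \<epsilon> by simp
    then show ?thesis using exp_gt_zero[of "2 * a"] by linarith
  qed
  consider "z - 1 > t" | "z + 1 \<le> t" | "z - 1 \<le> t" "t < z + 1" by linarith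
  then show ?thesis
  proof cases
    case 1
    have "report_prob \<epsilon> t (z + 1) \<le> 1" using report_prob_bounds[OF \<epsilon>(1)] less_imp_le by blast
    also have "1 \<le> 2 * report_prob \<epsilon> t (z - 1)"
      using 1 flip_prob_bounds(2)[OF \<epsilon>(1), of "z - 1" t] by (simp add: report_prob_def)
    also have "\<dots> \<le> 2 * exp (2 * a) * report_prob \<epsilon> t (z - 1)"
      using \<epsilon> report_prob_bounds[OF \<epsilon>(1), of t "z - 1"] by simp
    finally show ?thesis .
  next
    case 2
    then have "report_prob \<epsilon> t (z + 1) = exp (2 * \<epsilon>) * report_prob \<epsilon> t (z - 1)"
      by (simp add: report_prob_def flip_prob_def algebra_simps flip: exp_add)
    also have "\<dots> \<le> (2 * exp (2 * a)) * report_prob \<epsilon> t (z - 1)"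
      using ea report_prob_bounds[OF \<epsilon>(1), of t "z - 1"] by (intro mult_right_mono) auto
    finally show ?thesis .
  next
    case 3
    have "\<epsilon> * (t - z + 1) \<le> a * 2" using 3 \<epsilon> by (intro mult_mono) auto
    then have *: "exp (\<epsilon> * (t - z + 1)) \<le> exp (2 * a)" by (simp add: mult.commute)
    have "report_prob \<epsilon> t (z + 1) \<le> 1" using report_prob_bounds[OF \<epsilon>(1)] less_imp_le by blast
    also have "1 = 2 * exp (\<epsilon> * (t - z + 1)) * report_prob \<epsilon> t (z - 1)"
      using 3 by (simp add: report_prob_def flip_prob_def algebra_simps flip: exp_add)
    also have "\<dots> \<le> (2 * exp (2 * a)) * report_prob \<epsilon> t (z - 1)"
      using * report_prob_bounds[OF \<epsilon>(1), of t "z - 1"] by (intro mult_right_mono) auto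
    finally show ?thesis .
  qed
qed

text \<open>A signal below a nonpositive threshold is at distance at most
  \<open>\<bar>s\<bar>\<close> from it. The bound is free of \<open>t\<close>, which keeps the
  probability of a wrong report \<open>+1\<close> away from 0 for all
  \<open>l \<ge> 1\<close>.\<close>

lemma report_prob_ge:
  assumes \<epsilon>: "0 \<le> \<epsilon>" "\<epsilon> \<le> a" and t: "t \<le> 0"
  shows "report_prob \<epsilon> t s \<ge> exp (- a * \<bar>s\<bar>) / 2"
proof (cases "s > t")
  case True
  have "exp (- a * \<bar>s\<bar>) / 2 \<le> 1 / 2" using \<epsilon> by simp
  also have "1 / 2 \<le> report_prob \<epsilon> t s"
    using True flip_prob_bounds(2)[OF \<epsilon>(1), of s t] by (simp add: report_prob_def)
  finally show ?thesis .
next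
  case False
  have "\<epsilon> * (t - s) \<le> a * \<bar>s\<bar>" using False t \<epsilon> by (intro mult_mono) auto
  then show ?thesis using False by (simp add: report_prob_def flip_prob_def)
qed

section \<open>Bounds on the averaged report probabilities\<close>

locale gaussian_budget = G: prob_space G for G :: "real measure" +
  fixes \<sigma> a :: real
  assumes \<sigma>_pos: "\<sigma> > 0" and a_pos: "a > 0"
    and sets_G [measurable_cong]: "sets G = sets borel"
    and G_support: "emeasure G {0..a} = 1" and G_no_atom: "emeasure G {0} = 0"
begin

section \<open>Integration over centred noise and budget\<close>

definition noise :: "real measure" where
  "noise = density lborel (normal_density 0 \<sigma>)"

lemma sets_noise [measurable_cong]: "sets noise = sets borel"
  by (simp add: noise_def)

sublocale N: prob_space noise
  unfolding noise_def by (rule prob_space_normal_density[OF \<sigma>_pos])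

sublocale Q: pair_prob_space noise G ..

lemma space_G [simp]: "space G = UNIV"
  using sets_eq_imp_space_eq[OF sets_G] by simp

lemma space_noise [simp]: "space noise = UNIV"
  by (simp add: noise_def)

lemma AE_budget: "AE \<epsilon> in G. 0 < \<epsilon> \<and> \<epsilon> \<le> a"
proof -
  have "AE \<epsilon> in G. \<epsilon> \<in> {0..a}"
    using G.AE_prob_1[of "{0..a}"] G_support by (simp add: G.emeasure_eq_measure)
  moreover have "AE \<epsilon> in G. \<epsilon> \<notin> {0}"
    by (rule AE_not_in) (use G_no_atom in \<open>auto simp: null_sets_def\<close>)
  ultimately show ?thesis by eventually_elim auto
qed

lemma AE_pair_budget: "AE x in noise \<Otimes>\<^sub>M G. 0 < snd x \<and> snd x \<le> a"
  by (rule Q.AE_pair_measure) (use AE_budget in auto)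

lemma measurable_report_prob [measurable]:
  "(\<lambda>x. report_prob (snd x) t (fst x + c)) \<in> borel_measurable (noise \<Otimes>\<^sub>M G)"
  unfolding report_prob_def flip_prob_def by measurable

lemma integrable_report_prob:
  "integrable (noise \<Otimes>\<^sub>M G) (\<lambda>x. report_prob (snd x) t (fst x + c))"
proof (rule Q.integrable_const_bound[where B = 1])
  show "AE x in noise \<Otimes>\<^sub>M G. norm (report_prob (snd x) t (fst x + c)) \<le> 1"
    using AE_pair_budget
    by eventually_elim (auto simp: less_imp_le report_prob_bounds)
qed measurable

text \<open>Substituting \<open>s = z + \<theta>\<close> moves the state from the density into the
  integrand, so both states are compared on one product space.\<close>

lemma prob_plus_eq:
  "prob_plus G \<sigma> \<theta> l = (\<integral>x. report_prob (snd x) (thr \<sigma> l) (fst x + \<theta>) \<partial>(noise \<Otimes>\<^sub>M G))"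
proof -
  have "prob_plus G \<sigma> \<theta> l
      = (LINT s|lborel. normal_density \<theta> \<sigma> s * (LINT \<epsilon>|G. report_prob \<epsilon> (thr \<sigma> l) s))"
    by (simp add: prob_plus_def report_prob_def)
  also have "\<dots> = (LINT z|lborel. normal_density 0 \<sigma> z * (LINT \<epsilon>|G. report_prob \<epsilon> (thr \<sigma> l) (z + \<theta>)))"
    by (subst lborel_integral_real_affine[where c = 1 and t = \<theta>])
      (auto simp: normal_density_def add.commute)
  also have "\<dots> = (LINT z|noise. LINT \<epsilon>|G. report_prob \<epsilon> (thr \<sigma> l) (z + \<theta>))"
  proof -
    have [measurable]: "(\<lambda>z. LINT \<epsilon>|G. report_prob \<epsilon> (thr \<sigma> l) (z + \<theta>)) \<in> borel_measurable lborel"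
      unfolding report_prob_def flip_prob_def by measurable
    show ?thesis
      unfolding noise_def by (subst integral_density) auto
  qed
  also have "\<dots> = (\<integral>x. report_prob (snd x) (thr \<sigma> l) (fst x + \<theta>) \<partial>(noise \<Otimes>\<^sub>M G))"
    using Q.integral_fst'[OF integrable_report_prob[of "thr \<sigma> l" \<theta>]] by simp
  finally show ?thesis .
qed

lemma integral_pair_pos:
  assumes "integrable (noise \<Otimes>\<^sub>M G) f" "AE x in noise \<Otimes>\<^sub>M G. 0 < f x"
  shows "0 < (\<integral>x. f x \<partial>(noise \<Otimes>\<^sub>M G) :: real)"
  using Q.integral_less_AE_space[of "\<lambda>_. 0" f] assms by (simp add: Q.emeasure_space_1)

lemma prob_plus_bounds: "0 < prob_plus G \<sigma> \<theta> l" "prob_plus G \<sigma> \<theta> l < 1"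
proof -
  show "0 < prob_plus G \<sigma> \<theta> l"
    unfolding prob_plus_eq
    by (intro integral_pair_pos integrable_report_prob, use AE_pair_budget in eventually_elim)
      (auto intro: report_prob_bounds)
  have "0 < (\<integral>x. 1 - report_prob (snd x) (thr \<sigma> l) (fst x + \<theta>) \<partial>(noise \<Otimes>\<^sub>M G))"
    by (intro integral_pair_pos Bochner_Integration.integrable_diff integrable_report_prob,
        simp, use AE_pair_budget in eventually_elim)
      (auto intro: report_prob_bounds)
  then show "prob_plus G \<sigma> \<theta> l < 1"
    by (simp add: prob_plus_eq integrable_report_prob)
      (simp add: Q.prob_space)
qed

section \<open>Separation of the two states and size of one increment\<close>

lemma prob_plus_diff:
  "prob_plus G \<sigma> 1 l - prob_plus G \<sigma> (-1) l
     = (\<integral>x. report_prob (snd x) (thr \<sigma> l) (fst x + 1) - report_prob (snd x) (thr \<sigma> l) (fst x - 1)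
          \<partial>(noise \<Otimes>\<^sub>M G))"
  using Bochner_Integration.integral_diff[OF integrable_report_prob[of "thr \<sigma> l" 1]
      integrable_report_prob[of "thr \<sigma> l" "-1"]]
  by (simp add: prob_plus_eq)

text \<open>The constant is the mean of the factor in \<open>(z, \<epsilon>)\<close> of the
  pointwise bound, positive because the budget is almost surely positive. The exponent is
  \<open>a * \<bar>t\<bar>\<close> at \<open>t = thr \<sigma> l\<close>.\<close>

lemma prob_plus_diff_ge:
  obtains c where "c > 0"
    "\<And>l. prob_plus G \<sigma> 1 l - prob_plus G \<sigma> (-1) l \<ge> c * exp (- (a * \<sigma>\<^sup>2 / 2) * \<bar>l\<bar>)"
proof
  let ?g = "\<lambda>x. (1 - exp (- snd x)) / 2 * exp (- a * (1 + \<bar>fst x\<bar>))"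
  have int: "integrable (noise \<Otimes>\<^sub>M G) ?g"
  proof (rule Q.integrable_const_bound[where B = 1])
    show "AE x in noise \<Otimes>\<^sub>M G. norm (?g x) \<le> 1"
      using AE_pair_budget
    proof eventually_elim
      case (elim x)
      have "?g x \<le> 1 * 1" using elim a_pos by (intro mult_mono) (auto intro: order.trans[OF _ exp_ge_zero])
      moreover have "0 \<le> ?g x" using elim by auto
      ultimately show ?case by simp
    qed
  qed measurable
  show "0 < (\<integral>x. ?g x \<partial>(noise \<Otimes>\<^sub>M G))"
    by (rule integral_pair_pos[OF int], use AE_pair_budget in eventually_elim) auto
  fix l
  let ?t = "thr \<sigma> l"
  have t: "exp (- (a * \<sigma>\<^sup>2 / 2) * \<bar>l\<bar>) = exp (- a * \<bar>?t\<bar>)" by (simp add: thr_def abs_mult)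
  have "(\<integral>x. ?g x \<partial>(noise \<Otimes>\<^sub>M G)) * exp (- (a * \<sigma>\<^sup>2 / 2) * \<bar>l\<bar>)
      = (\<integral>x. ?g x * exp (- a * \<bar>?t\<bar>) \<partial>(noise \<Otimes>\<^sub>M G))"
    unfolding t by (rule integral_mult_left_zero[symmetric])
  also have "\<dots> \<le> prob_plus G \<sigma> 1 l - prob_plus G \<sigma> (-1) l"
    unfolding prob_plus_diff
  proof (rule integral_mono_AE)
    show "AE x in noise \<Otimes>\<^sub>M G. ?g x * exp (- a * \<bar>?t\<bar>)
        \<le> report_prob (snd x) ?t (fst x + 1) - report_prob (snd x) ?t (fst x - 1)"
      using AE_pair_budget
    proof eventually_elim
      case (elim x)
      have "?g x * exp (- a * \<bar>?t\<bar>) = (1 - exp (- snd x)) / 2 * exp (- a * (1 + \<bar>fst x\<bar> + \<bar>?t\<bar>))"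
        by (simp add: algebra_simps flip: exp_add)
      also have "\<dots> \<le> report_prob (snd x) ?t (fst x + 1) - report_prob (snd x) ?t (fst x - 1)"
        using elim by (intro report_prob_diff_ge) auto
      finally show ?case .
    qed
    show "integrable (noise \<Otimes>\<^sub>M G) (\<lambda>x. ?g x * exp (- a * \<bar>?t\<bar>))"
      by (intro integrable_mult_left int)
  qed (use integrable_report_prob[of ?t 1] integrable_report_prob[of ?t "-1"] in auto)
  finally show "(\<integral>x. ?g x \<partial>(noise \<Otimes>\<^sub>M G)) * exp (- (a * \<sigma>\<^sup>2 / 2) * \<bar>l\<bar>)
      \<le> prob_plus G \<sigma> 1 l - prob_plus G \<sigma> (-1) l" .
qed

lemma ln_prob_plus_ratio_le:
  "ln (prob_plus G \<sigma> 1 l / prob_plus G \<sigma> (-1) l) \<le> ln (2 * exp (2 * a))"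
proof -
  let ?t = "thr \<sigma> l"
  have "prob_plus G \<sigma> 1 l
      \<le> (\<integral>x. 2 * exp (2 * a) * report_prob (snd x) ?t (fst x + (-1)) \<partial>(noise \<Otimes>\<^sub>M G))"
    unfolding prob_plus_eq
  proof (rule integral_mono_AE)
    show "AE x in noise \<Otimes>\<^sub>M G. report_prob (snd x) ?t (fst x + 1)
        \<le> 2 * exp (2 * a) * report_prob (snd x) ?t (fst x + (-1))"
      using AE_pair_budget by eventually_elim (auto simp: report_prob_ratio_le)
  qed (auto simp only: integrable_report_prob intro!: integrable_mult_right)
  also have "\<dots> = 2 * exp (2 * a) * prob_plus G \<sigma> (-1) l"
    by (simp only: prob_plus_eq integral_mult_right_zero)
  finally show ?thesis
    using prob_plus_bounds(1)[of 1 l] prob_plus_bounds(1)[of "-1" l]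
    by (intro ln_mono) (auto simp: pos_divide_le_eq)
qed

lemma integrable_noise_abs: "integrable noise (\<lambda>z. \<bar>z\<bar>)"
  unfolding noise_def
  using integrable_normal_moment_abs[OF \<sigma>_pos, of 0 1] by (subst integrable_density) auto

text \<open>By \<open>ln r \<le> r - 1\<close>, the log ratio is at most the gap divided by the
  probability in state -1. The gap is at most \<open>m / \<bar>t\<bar>\<close>, finite because the
  noise has a first absolute moment, and the denominator is at least \<open>c\<close>. Since
  \<open>\<bar>t\<bar> = \<sigma>\<^sup>2 * l / 2\<close>, the constant is
  \<open>2 * m / (c * \<sigma>\<^sup>2)\<close>.\<close>

lemma ln_prob_plus_ratio_le_inverse:
  obtains C where "C > 0"
    "\<And>l. l \<ge> 1 \<Longrightarrow> ln (prob_plus G \<sigma> 1 l / prob_plus G \<sigma> (-1) l) \<le> C / l"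
proof -
  let ?g = "\<lambda>x. exp (- a * \<bar>fst x + (-1)\<bar>) / 2 :: real"
  define c where "c = (\<integral>x. ?g x \<partial>(noise \<Otimes>\<^sub>M G))"
  define m where "m = (\<integral>x. 2 * (1 + \<bar>fst x\<bar>) \<partial>(noise \<Otimes>\<^sub>M G))"
  have int_g: "integrable (noise \<Otimes>\<^sub>M G) ?g"
  proof (rule Q.integrable_const_bound[where B = 1])
    have "?g x \<le> 1" for x :: "real \<times> real"
    proof -
      have "exp (- a * \<bar>fst x + (-1)\<bar>) \<le> 1" using a_pos by simp
      then show ?thesis by linarith
    qed
    then show "AE x in noise \<Otimes>\<^sub>M G. norm (?g x) \<le> 1" by simp
  qed measurable
  have int_m: "integrable (noise \<Otimes>\<^sub>M G) (\<lambda>x. 2 * (1 + \<bar>fst x\<bar>))"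
    using integrable_noise_abs by (intro Q.Fubini_integrable) (auto simp: G.prob_space)
  have c: "c > 0" unfolding c_def by (rule integral_pair_pos[OF int_g]) auto
  have m: "m > 0" unfolding m_def by (rule integral_pair_pos[OF int_m]) (auto intro!: AE_I2 add_pos_nonneg)
  show ?thesis
  proof
    show "2 * m / (c * \<sigma>\<^sup>2) > 0" using c m \<sigma>_pos by simp
    fix l :: real assume l: "l \<ge> 1"
    let ?t = "thr \<sigma> l"
    have t: "?t < 0" "\<bar>?t\<bar> = \<sigma>\<^sup>2 * l / 2" using l \<sigma>_pos by (auto simp: thr_def abs_mult)
    have low: "c \<le> prob_plus G \<sigma> (-1) l"
      unfolding prob_plus_eq c_def
    proof (rule integral_mono_AE[OF int_g integrable_report_prob])
      show "AE x in noise \<Otimes>\<^sub>M G. ?g x \<le> report_prob (snd x) ?t (fst x + (-1))"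
        using AE_pair_budget by eventually_elim (use t in \<open>intro report_prob_ge; simp\<close>)
    qed
    have "prob_plus G \<sigma> 1 l - prob_plus G \<sigma> (-1) l
        \<le> (\<integral>x. 2 * (1 + \<bar>fst x\<bar>) / \<bar>?t\<bar> \<partial>(noise \<Otimes>\<^sub>M G))"
      unfolding prob_plus_diff
    proof (rule integral_mono_AE)
      show "AE x in noise \<Otimes>\<^sub>M G. report_prob (snd x) ?t (fst x + 1) - report_prob (snd x) ?t (fst x - 1)
          \<le> 2 * (1 + \<bar>fst x\<bar>) / \<bar>?t\<bar>"
        using AE_pair_budget by eventually_elim (use t in \<open>intro report_prob_diff_le; simp\<close>)
    qed (use int_m integrable_report_prob[of ?t 1] integrable_report_prob[of ?t "-1"] in auto)
    also have "\<dots> = m / \<bar>?t\<bar>" unfolding m_def by (rule integral_divide_zero)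
    finally have diff: "prob_plus G \<sigma> 1 l - prob_plus G \<sigma> (-1) l \<le> m / \<bar>?t\<bar>" .
    have "ln (prob_plus G \<sigma> 1 l / prob_plus G \<sigma> (-1) l) \<le> prob_plus G \<sigma> 1 l / prob_plus G \<sigma> (-1) l - 1"
      using prob_plus_bounds[of 1 l] prob_plus_bounds[of "-1" l] by (intro ln_le_minus_one) auto
    also have "\<dots> = (prob_plus G \<sigma> 1 l - prob_plus G \<sigma> (-1) l) / prob_plus G \<sigma> (-1) l"
      using prob_plus_bounds[of "-1" l] by (simp add: field_simps)
    also have "\<dots> \<le> (m / \<bar>?t\<bar>) / c"
      by (intro frac_le diff low c) (use m in simp)
    also have "\<dots> = 2 * m / (c * \<sigma>\<^sup>2) / l" by (simp add: t field_simps)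
    finally show "ln (prob_plus G \<sigma> 1 l / prob_plus G \<sigma> (-1) l) \<le> 2 * m / (c * \<sigma>\<^sup>2) / l" .
  qed
qed

end

section \<open>Deterministic recursions\<close>

lemma sqrt_growth:
  fixes x :: "nat \<Rightarrow> real"
  assumes C: "C \<ge> 0" and x0: "x 0 = 0"
    and small: "\<And>n. x (Suc n) \<le> x n + C"
    and large: "\<And>n. x n \<ge> 1 \<Longrightarrow> x (Suc n) \<le> x n + C / x n"
  shows "x n \<le> (1 + C) * sqrt (real n)"
proof -
  \<comment> \<open>Only upper bounds on the increments are known, so the positive part is squared.
    Its square grows by at most \<open>2 * C + C\<^sup>2\<close> from \<open>x n \<ge> 1\<close>,
    and from below 1 the next value is at most \<open>1 + C\<close>.\<close>
  have "(max 0 (x n))\<^sup>2 \<le> (1 + C)\<^sup>2 * real n"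
  proof (induction n)
    case (Suc n)
    show ?case
    proof (cases "x n \<ge> 1")
      case True
      have "C / x n \<le> C" using True C mult_left_mono[of 1 "x n" C] by (simp add: field_simps)
      then have c: "(C / x n)\<^sup>2 \<le> C\<^sup>2" using C True by (intro power_mono) auto
      have "(max 0 (x (Suc n)))\<^sup>2 \<le> (x n + C / x n)\<^sup>2"
        using large[OF True] True C by (intro power_mono) (auto intro!: add_nonneg_nonneg)
      also have "\<dots> = (x n)\<^sup>2 + 2 * C + (C / x n)\<^sup>2"
        using True by (simp add: power2_sum)
      also have "\<dots> \<le> (max 0 (x n))\<^sup>2 + (1 + C)\<^sup>2"
        using True c by (simp add: power2_sum)
      finally show ?thesis using Suc by (simp add: algebra_simps)
    next
      case False
      have "(max 0 (x (Suc n)))\<^sup>2 \<le> (1 + C)\<^sup>2"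
        using small[of n] False C by (intro power_mono) auto
      also have "\<dots> \<le> (1 + C)\<^sup>2 * real (Suc n)"
        by (simp add: mult_le_cancel_left1)
      finally show ?thesis .
    qed
  qed (simp add: x0)
  then have "max 0 (x n) \<le> sqrt ((1 + C)\<^sup>2 * real n)" by (rule real_le_rsqrt)
  then show ?thesis using C by (simp add: real_sqrt_mult)
qed

text \<open>The left side is the Hellinger affinity of two Bernoulli laws. Factoring
  \<open>x - y\<close> over square roots, whose sum is at most 2, bounds
  \<open>(x - y)\<^sup>2\<close> by 4 times the squared difference of the roots; this is added up
  over both outcomes.\<close>

lemma bernoulli_affinity_le:
  fixes p q :: real
  assumes "0 < p" "p < 1" "0 < q" "q < 1"
  shows "sqrt (p * q) + sqrt ((1 - p) * (1 - q)) \<le> 1 - (p - q)\<^sup>2 / 4"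
proof -
  have *: "8 * sqrt (x * y) \<le> 4 * (x + y) - (x - y)\<^sup>2" if "0 < x" "x < 1" "0 < y" "y < 1" for x y :: real
  proof -
    have le2: "0 \<le> sqrt x + sqrt y" "sqrt x + sqrt y \<le> 2"
      using that real_sqrt_le_1_iff[of x] real_sqrt_le_1_iff[of y] by (auto simp del: real_sqrt_le_1_iff)
    have "(x - y)\<^sup>2 = (sqrt x - sqrt y)\<^sup>2 * (sqrt x + sqrt y)\<^sup>2"
      using that by (simp add: algebra_simps flip: power_mult_distrib)
    also have "\<dots> \<le> (sqrt x - sqrt y)\<^sup>2 * 2\<^sup>2"
      using le2 by (intro mult_left_mono power_mono) auto
    also have "\<dots> = 4 * (x + y - 2 * sqrt (x * y))"
      using that by (simp add: power2_diff real_sqrt_mult)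
    finally have "(x - y)\<^sup>2 \<le> 4 * (x + y - 2 * sqrt (x * y))" .
    then show ?thesis by simp
  qed
  from *[of p q] *[of "1 - p" "1 - q"] assms show ?thesis
    by (simp add: power2_commute[of q p])
qed

text \<open>Discrete form of the equation \<open>m' = - \<delta> * m powr (K + 1)\<close>: by
  \<open>1 - x \<le> exp (- x)\<close>, the quantity \<open>m n powr (- K)\<close> gains at least
  \<open>\<delta> * K\<close> in each step.\<close>

lemma power_decay:
  fixes m :: "nat \<Rightarrow> real"
  assumes pos: "\<And>n. m n > 0" and \<delta>: "\<delta> > 0" and K: "K > 0"
    and step: "\<And>n. m (Suc n) \<le> m n * (1 - \<delta> * m n powr K)"
  shows "n > 0 \<Longrightarrow> m n \<le> (\<delta> * K * real n) powr (- 1 / K)"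
proof -
  have inv: "\<delta> * K * real n \<le> m n powr (- K)" for n
  proof (induction n)
    case (Suc n)
    have "m (Suc n) \<le> m n * exp (- (\<delta> * m n powr K))"
      using step[of n] pos[of n] exp_ge_add_one_self[of "- (\<delta> * m n powr K)"]
      by (smt (verit) mult_left_mono)
    then have "m (Suc n) powr (- K) \<ge> (m n * exp (- (\<delta> * m n powr K))) powr (- K)"
      using pos[of "Suc n"] K by (intro powr_mono2') auto
    also have "(m n * exp (- (\<delta> * m n powr K))) powr (- K) = m n powr (- K) * exp (K * \<delta> * m n powr K)"
      using pos[of n] by (simp add: powr_mult powr_def[of "exp _"] mult_ac)
    finally have "m (Suc n) powr (- K) \<ge> m n powr (- K) * exp (K * \<delta> * m n powr K)" .
    moreover have "m n powr (- K) * exp (K * \<delta> * m n powr K) \<ge> m n powr (- K) * (1 + K * \<delta> * m n powr K)"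
      using exp_ge_add_one_self by (intro mult_left_mono) auto
    moreover have "m n powr (- K) * (1 + K * \<delta> * m n powr K)
        = m n powr (- K) + K * \<delta> * (m n powr (- K) * m n powr K)"
      by (simp add: algebra_simps)
    moreover have "m n powr (- K) * m n powr K = 1"
      using pos[of n] by (simp add: powr_minus)
    moreover have "\<delta> * K * real (Suc n) = \<delta> * K * real n + K * \<delta>"
      by (simp add: algebra_simps)
    ultimately show ?case using Suc by simp
  qed simp
  assume n: "n > 0"
  have "m n = (m n powr (- K)) powr (- 1 / K)"
    using pos[of n] K by (simp add: powr_powr)
  also have "\<dots> \<le> (\<delta> * K * real n) powr (- 1 / K)"
    using inv[of n] \<delta> K n by (intro powr_mono2') auto
  finally show "m n \<le> (\<delta> * K * real n) powr (- 1 / K)" .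
qed

section \<open>Growth of a log-likelihood ratio process\<close>

text \<open>\<open>p\<close> is the true law of a report and \<open>q\<close> its law under the
  other state. \<open>one_step\<close> is the conditional law of the next report in integrated form,
  so the supermartingale arguments need no conditional expectations.\<close>

locale llr_process = prob_space M for M :: "'a measure" +
  fixes H :: "nat \<Rightarrow> 'a \<Rightarrow> bool list" and L :: "bool list \<Rightarrow> real"
    and p q :: "real \<Rightarrow> real" and c k :: real
  assumes H_measurable [measurable]: "\<And>n. H n \<in> measurable M (count_space UNIV)"
    and H_0: "\<And>\<omega>. H 0 \<omega> = []"
    and H_Suc: "\<And>n \<omega>. \<exists>b. H (Suc n) \<omega> = b # H n \<omega>"
    and one_step: "\<And>n (F :: bool list \<Rightarrow> real). expectation (\<lambda>\<omega>. F (H (Suc n) \<omega>))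
          = expectation (\<lambda>\<omega>. p (L (H n \<omega>)) * F (True # H n \<omega>) + (1 - p (L (H n \<omega>))) * F (False # H n \<omega>))"
    and L_Nil: "L [] = 0"
    and L_True: "\<And>xs. L (True # xs) = L xs + ln (p (L xs) / q (L xs))"
    and L_False: "\<And>xs. L (False # xs) = L xs + ln ((1 - p (L xs)) / (1 - q (L xs)))"
    and p_bounds: "\<And>l. 0 < p l" "\<And>l. p l < 1"
    and q_bounds: "\<And>l. 0 < q l" "\<And>l. q l < 1"
    and c_pos: "c > 0" and k_pos: "k > 0"
    and gap: "\<And>l. p l - q l \<ge> c * exp (- k * \<bar>l\<bar>)"
begin

lemma length_H: "length (H n \<omega>) = n"
proof (induction n)
  case (Suc n)
  then show ?case using H_Suc[of n \<omega>] by auto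
qed (simp add: H_0)

text \<open>There are finitely many histories of length \<open>n\<close>, so every function is
  bounded on them.\<close>

lemma integrable_H: "integrable M (\<lambda>\<omega>. F (H n \<omega>) :: real)"
proof (rule integrable_const_bound[where B = "Max ((\<lambda>xs. norm (F xs)) ` {xs. length xs = n})"])
  have fin: "finite {xs :: bool list. length xs = n}"
    using finite_lists_length_eq[of "UNIV :: bool set" n] by simp
  show "AE \<omega> in M. norm (F (H n \<omega>)) \<le> Max ((\<lambda>xs. norm (F xs)) ` {xs. length xs = n})"
    by (intro AE_I2 Max_ge finite_imageI fin imageI) (simp add: length_H)
qed measurable

lemma expectation_mono_H:
  assumes "\<And>xs. length xs = n \<Longrightarrow> F xs \<le> (G xs :: real)"
  shows "expectation (\<lambda>\<omega>. F (H n \<omega>)) \<le> expectation (\<lambda>\<omega>. G (H n \<omega>))"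
  by (intro integral_mono integrable_H assms length_H)

text \<open>Square root of the likelihood ratio of \<open>q\<close> against
  \<open>p\<close>.\<close>

definition Y :: "bool list \<Rightarrow> real" where
  "Y xs = exp (- L xs / 2)"

text \<open>Weighting the outcomes of a step under \<open>p\<close> by the likelihood ratio turns
  them into those under \<open>q\<close>, which also sum to 1.\<close>

lemma expectation_Y2: "expectation (\<lambda>\<omega>. (Y (H n \<omega>))\<^sup>2) = 1"
proof -
  have Y2: "(Y xs)\<^sup>2 = exp (- L xs)" for xs
    by (simp add: Y_def flip: exp_double)
  have "expectation (\<lambda>\<omega>. exp (- L (H n \<omega>))) = 1"
  proof (induction n)
    case 0
    show ?case by (simp add: H_0 L_Nil prob_space)
  next
    case (Suc n)
    have "p (L xs) * exp (- L (True # xs)) + (1 - p (L xs)) * exp (- L (False # xs)) = exp (- L xs)" for xs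
    proof -
      have "p (L xs) * exp (- L (True # xs)) = q (L xs) * exp (- L xs)"
        using p_bounds[of "L xs"] q_bounds[of "L xs"]
        by (simp add: L_True exp_diff exp_minus field_simps)
      moreover have "(1 - p (L xs)) * exp (- L (False # xs)) = (1 - q (L xs)) * exp (- L xs)"
        using p_bounds[of "L xs"] q_bounds[of "L xs"]
        by (simp add: L_False exp_diff exp_minus field_simps)
      ultimately show ?thesis by (simp add: algebra_simps)
    qed
    then show ?case using Suc by (simp add: one_step[of "\<lambda>xs. exp (- L xs)"])
  qed
  then show ?thesis by (simp add: Y2)
qed

text \<open>The mean factor of one step is exactly the Hellinger affinity of the report laws;
  \<open>gap\<close> then bounds it away from 1.\<close>

lemma Y_step:
  "p (L xs) * Y (True # xs) + (1 - p (L xs)) * Y (False # xs)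
     \<le> Y xs * (1 - c\<^sup>2 / 4 * exp (- 2 * k * \<bar>L xs\<bar>))"
proof -
  have *: "r * exp (- ln (r / s) / 2) = sqrt (r * s)" if "r > 0" "s > 0" for r s :: real
  proof -
    have "exp (- ln (r / s) / 2) = sqrt (s / r)"
      using that by (simp add: powr_half_sqrt[symmetric] powr_def ln_div)
    moreover have "r * sqrt (s / r) = sqrt (r * s)"
      using that by (simp add: real_sqrt_divide real_sqrt_mult field_simps)
    ultimately show ?thesis by simp
  qed
  let ?p = "p (L xs)" and ?q = "q (L xs)"
  have pq: "0 < ?p" "?p < 1" "0 < ?q" "?q < 1" using p_bounds q_bounds by auto
  have YT: "Y (True # xs) = Y xs * exp (- ln (?p / ?q) / 2)"
    and YF: "Y (False # xs) = Y xs * exp (- ln ((1 - ?p) / (1 - ?q)) / 2)"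
    by (simp_all add: Y_def L_True L_False add_divide_distrib diff_divide_distrib flip: exp_add)
  have "?p * Y (True # xs) + (1 - ?p) * Y (False # xs)
      = Y xs * (?p * exp (- ln (?p / ?q) / 2) + (1 - ?p) * exp (- ln ((1 - ?p) / (1 - ?q)) / 2))"
    unfolding YT YF by (simp add: algebra_simps)
  also have "\<dots> = Y xs * (sqrt (?p * ?q) + sqrt ((1 - ?p) * (1 - ?q)))"
    using *[of ?p ?q] *[of "1 - ?p" "1 - ?q"] pq by simp
  also have "\<dots> \<le> Y xs * (1 - (?p - ?q)\<^sup>2 / 4)"
    using bernoulli_affinity_le[OF pq] by (intro mult_left_mono) (auto simp: Y_def)
  also have "\<dots> \<le> Y xs * (1 - (c * exp (- k * \<bar>L xs\<bar>))\<^sup>2 / 4)"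
    using gap[of "L xs"] c_pos
    by (intro mult_left_mono diff_left_mono divide_right_mono power_mono) (auto simp: Y_def)
  also have "(c * exp (- k * \<bar>L xs\<bar>))\<^sup>2 / 4 = c\<^sup>2 / 4 * exp (- 2 * k * \<bar>L xs\<bar>)"
    by (simp add: power_mult_distrib mult.assoc flip: exp_double)
  finally show ?thesis .
qed

lemma Y_supermartingale_step:
  "p (L xs) * Y (True # xs) + (1 - p (L xs)) * Y (False # xs) \<le> Y xs"
proof -
  have "Y xs * (1 - c\<^sup>2 / 4 * exp (- 2 * k * \<bar>L xs\<bar>)) \<le> Y xs * 1"
    by (intro mult_left_mono) (auto simp: Y_def)
  then show ?thesis using Y_step[of xs] by simp
qed

text \<open>A pointwise lower bound, quadratic in \<open>Y\<close>, so that its mean involves only \<open>E Y = m\<close> and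
  \<open>E Y\<^sup>2 = 1\<close>; the right-hand side is nonpositive unless \<open>m / 4 \<le> Y \<le> 4 / m\<close>.\<close>
lemma Y_damping:
  assumes "m > 0"
  shows "Y xs * exp (- 2 * k * \<bar>L xs\<bar>) \<ge> (m / 4) powr (4 * k) * (Y xs - m / 4 - m / 4 * (Y xs)\<^sup>2)"
proof (cases "m / 4 \<le> Y xs \<and> Y xs \<le> 4 / m")
  case True
  have Y: "Y xs > 0" by (simp add: Y_def)
  have inv: "exp (L xs / 2) = 1 / Y xs" by (simp add: Y_def exp_minus field_simps)
  \<comment> \<open>\<open>exp (- \<bar>L xs\<bar> / 2)\<close> is the smaller of
    \<open>Y xs\<close> and \<open>1 / Y xs\<close>, and both are at least \<open>m / 4\<close>
    here. The power \<open>4 * k\<close> turns it into the required exponential.\<close>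
  have "m / 4 \<le> 1 / Y xs" using True Y assms by (simp add: field_simps)
  then have "m / 4 \<le> exp (- \<bar>L xs\<bar> / 2)"
    using True inv by (cases "L xs \<ge> 0") (auto simp: Y_def)
  then have "(m / 4) powr (4 * k) \<le> exp (- \<bar>L xs\<bar> / 2) powr (4 * k)"
    using assms k_pos by (intro powr_mono2) auto
  also have "\<dots> = exp (- 2 * k * \<bar>L xs\<bar>)" by (simp add: powr_def)
  finally have "(m / 4) powr (4 * k) * Y xs \<le> exp (- 2 * k * \<bar>L xs\<bar>) * Y xs"
    using Y by (intro mult_right_mono) auto
  moreover have "(m / 4) powr (4 * k) * (Y xs - m / 4 - m / 4 * (Y xs)\<^sup>2) \<le> (m / 4) powr (4 * k) * Y xs"
  proof (rule mult_left_mono)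
    have "0 \<le> m / 4 * (Y xs)\<^sup>2" using assms by simp
    then show "Y xs - m / 4 - m / 4 * (Y xs)\<^sup>2 \<le> Y xs" using assms by linarith
  qed simp
  ultimately show ?thesis by (simp only: mult.commute[of "Y xs"])
next
  case False
  have "Y xs - m / 4 - m / 4 * (Y xs)\<^sup>2 \<le> 0"
  proof (cases "Y xs < m / 4")
    case True
    moreover have "0 \<le> m / 4 * (Y xs)\<^sup>2" using assms by simp
    ultimately show ?thesis by linarith
  next
    case False
    with \<open>\<not> (m / 4 \<le> Y xs \<and> Y xs \<le> 4 / m)\<close> have "1 \<le> m / 4 * Y xs" using assms by (simp add: field_simps)
    then have "1 * Y xs \<le> m / 4 * Y xs * Y xs" by (intro mult_right_mono) (auto simp: Y_def)
    then show ?thesis using assms by (simp add: power2_eq_square mult.assoc)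
  qed
  then have "(m / 4) powr (4 * k) * (Y xs - m / 4 - m / 4 * (Y xs)\<^sup>2) \<le> 0"
    by (intro mult_nonneg_nonpos) auto
  also have "0 \<le> Y xs * exp (- 2 * k * \<bar>L xs\<bar>)" by (simp add: Y_def)
  finally show ?thesis .
qed

section \<open>Recursion for the mean\<close>

definition m :: "nat \<Rightarrow> real" where
  "m n = expectation (\<lambda>\<omega>. Y (H n \<omega>))"

lemma m_pos: "m n > 0"
  using integral_less_AE_space[of "\<lambda>_. 0" "\<lambda>\<omega>. Y (H n \<omega>)"] integrable_H[of Y n]
  by (simp add: m_def Y_def emeasure_space_1)

text \<open>Half of the Hellinger constant \<open>c\<^sup>2 / 4\<close>, times the contribution of
  the 4 in the cut-off \<open>m / 4\<close>.\<close>

definition \<delta> :: real where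
  "\<delta> = c\<^sup>2 / 8 * (1 / 4) powr (4 * k)"

lemma m_Suc_le: "m (Suc n) \<le> m n * (1 - \<delta> * m n powr (4 * k))"
proof -
  define B where "B = c\<^sup>2 / 4 * (m n / 4) powr (4 * k)"
  have int: "integrable M (\<lambda>\<omega>. Y (H n \<omega>))" "integrable M (\<lambda>\<omega>. (Y (H n \<omega>))\<^sup>2)"
    using integrable_H[of Y n] integrable_H[of "\<lambda>xs. (Y xs)\<^sup>2" n] by auto
  have "m (Suc n) \<le> expectation (\<lambda>\<omega>. Y (H n \<omega>) - B * (Y (H n \<omega>) - m n / 4 - m n / 4 * (Y (H n \<omega>))\<^sup>2))"
    unfolding m_def[of "Suc n"] one_step
  proof (rule expectation_mono_H)
    fix xs :: "bool list"
    have "B * (Y xs - m n / 4 - m n / 4 * (Y xs)\<^sup>2) \<le> c\<^sup>2 / 4 * (Y xs * exp (- 2 * k * \<bar>L xs\<bar>))"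
      using mult_left_mono[OF Y_damping[OF m_pos[of n], of xs], of "c\<^sup>2 / 4"] by (simp add: B_def mult.assoc)
    then show "p (L xs) * Y (True # xs) + (1 - p (L xs)) * Y (False # xs)
        \<le> Y xs - B * (Y xs - m n / 4 - m n / 4 * (Y xs)\<^sup>2)"
      using Y_step[of xs] by (simp add: algebra_simps)
  qed
  \<comment> \<open>Since \<open>Y\<^sup>2\<close> has mean 1, the two corrections cost
    \<open>m n / 4\<close> each and half of \<open>m n\<close> survives.\<close>
  also have "\<dots> = m n - B * (m n - m n / 4 - m n / 4)"
    using int by (simp add: prob_space expectation_Y2 m_def[symmetric])
  also have "\<dots> = m n * (1 - \<delta> * m n powr (4 * k))"
    using m_pos[of n] powr_mult[of "m n" "1 / 4" "4 * k"] by (simp add: B_def \<delta>_def algebra_simps)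
  finally show ?thesis .
qed

text \<open>Records whether \<open>Y\<close> reached \<open>\<rho>\<close> at some time from
  \<open>n\<close> on. Being a function of the history, it makes the stopped process one as well, so
  \<open>one_step\<close> applies to it.\<close>

fun hit :: "real \<Rightarrow> nat \<Rightarrow> bool list \<Rightarrow> bool" where
  "hit \<rho> n [] \<longleftrightarrow> n = 0 \<and> \<rho> \<le> Y []"
| "hit \<rho> n (x # xs) \<longleftrightarrow> hit \<rho> n xs \<or> (n \<le> Suc (length xs) \<and> \<rho> \<le> Y (x # xs))"

lemma hit_length: "hit \<rho> n xs \<Longrightarrow> n \<le> length xs"
  by (induction xs) auto

lemma hit_H:
  assumes "n \<le> j" "j \<le> N" "\<rho> \<le> Y (H j \<omega>)"
  shows "hit \<rho> n (H N \<omega>)"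
  using assms(2)
proof (induction N rule: dec_induct)
  case base
  show ?case using assms length_H[of j \<omega>] by (cases "H j \<omega>") auto
next
  case (step N)
  then show ?case using H_Suc[of N \<omega>] by auto
qed

text \<open>Doob's maximal inequality for the nonnegative supermartingale \<open>Y (H j \<omega>)\<close>, with the process
  frozen at \<open>\<rho>\<close> from the first time \<open>j \<ge> n\<close> at which it reaches \<open>\<rho>\<close>.\<close>
lemma maximal_inequality:
  assumes \<rho>: "\<rho> > 0" and nN: "n \<le> N"
  shows "prob {\<omega> \<in> space M. \<exists>j\<in>{n..N}. \<rho> \<le> Y (H j \<omega>)} \<le> m n / \<rho>"
proof -
  define F where "F xs = (if hit \<rho> n xs then \<rho> else Y xs)" for xs
  have F_le: "p (L xs) * F (True # xs) + (1 - p (L xs)) * F (False # xs) \<le> F xs" for xs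
  proof (cases "hit \<rho> n xs")
    case True
    then show ?thesis by (simp add: F_def algebra_simps)
  next
    case False
    \<comment> \<open>At a first hit \<open>F\<close> drops from \<open>Y\<close> to
      \<open>\<rho>\<close>, which is no larger.\<close>
    then have "F (b # xs) \<le> Y (b # xs)" for b by (simp add: F_def)
    then have "p (L xs) * F (True # xs) + (1 - p (L xs)) * F (False # xs)
        \<le> p (L xs) * Y (True # xs) + (1 - p (L xs)) * Y (False # xs)"
      using p_bounds[of "L xs"] by (intro add_mono mult_left_mono) auto
    then show ?thesis using Y_supermartingale_step[of xs] False by (simp add: F_def)
  qed
  have F_m: "expectation (\<lambda>\<omega>. F (H N \<omega>)) \<le> m n"
    using nN
  proof (induction N rule: dec_induct)
    case base
    show ?case unfolding m_def
    proof (rule expectation_mono_H)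
      fix xs :: "bool list" assume "length xs = n"
      \<comment> \<open>The tail is too short to contain a hit, so a hit can occur only at the
        present time, where \<open>\<rho> \<le> Y xs\<close>.\<close>
      then show "F xs \<le> Y xs"
        using hit_length[of \<rho> n "tl xs"] by (cases xs) (auto simp: F_def)
    qed
  next
    case (step N)
    have "expectation (\<lambda>\<omega>. F (H (Suc N) \<omega>)) \<le> expectation (\<lambda>\<omega>. F (H N \<omega>))"
      unfolding one_step[of F] by (rule expectation_mono_H) (rule F_le)
    then show ?case using step by simp
  qed
  have "prob {\<omega> \<in> space M. \<exists>j\<in>{n..N}. \<rho> \<le> Y (H j \<omega>)} \<le> prob {\<omega> \<in> space M. hit \<rho> n (H N \<omega>)}"
    by (intro finite_measure_mono) (auto intro: hit_H)
  also have "\<dots> = expectation (indicator {\<omega> \<in> space M. hit \<rho> n (H N \<omega>)})"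
    by simp
  \<comment> \<open>Markov's inequality: \<open>F\<close> equals \<open>\<rho>\<close> on the event
    and is nonnegative elsewhere.\<close>
  also have "\<dots> \<le> expectation (\<lambda>\<omega>. F (H N \<omega>) / \<rho>)"
    using \<rho> by (intro integral_mono integrable_H integrable_real_indicator)
      (auto simp: F_def indicator_def Y_def emeasure_eq_measure)
  also have "\<dots> \<le> m n / \<rho>"
    using F_m \<rho> by (simp add: divide_right_mono)
  finally show ?thesis .
qed

section \<open>Almost sure decay along dyadic blocks\<close>

lemma log_growth: "AE \<omega> in M. \<exists>c>0. \<forall>\<^sub>F n in sequentially. L (H n \<omega>) \<ge> c * ln (real n)"
proof -
  define K where "K = 4 * k"
  have K: "K > 0" using k_pos by (simp add: K_def)
  have \<delta>: "\<delta> > 0" using c_pos by (simp add: \<delta>_def)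
  \<comment> \<open>The mean at time \<open>2 ^ i\<close> is of order
    \<open>2 powr (- i / K)\<close>. Its square root is taken as the level: the quotient of mean and
    level is still geometric, hence summable, and staying below the level still forces linear growth
    of \<open>L\<close> in \<open>i\<close>.\<close>
  define lam where "lam i = 2 powr (- real i / (2 * K))" for i :: nat
  define A where "A i = {\<omega> \<in> space M. \<exists>j\<in>{2^i..2^Suc i}. lam i \<le> Y (H j \<omega>)}" for i :: nat
  define r where "r = 2 powr (- 1 / (2 * K))"
  have r: "0 < r" "r < 1" using K by (auto simp: r_def powr_less_one)
  have [measurable]: "A i \<in> sets M" for i unfolding A_def by measurable
  have bound: "prob (A i) \<le> (\<delta> * K) powr (- 1 / K) * r ^ i" for i
  proof -
    have "prob (A i) \<le> m (2 ^ i) / lam i"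
      unfolding A_def by (rule maximal_inequality) (auto simp: lam_def)
    also have "\<dots> \<le> (\<delta> * K * real (2 ^ i)) powr (- 1 / K) / lam i"
      using power_decay[of m \<delta> K "2 ^ i"] m_pos \<delta> K m_Suc_le
      by (intro divide_right_mono) (auto simp: K_def lam_def)
    also have "\<dots> = (\<delta> * K) powr (- 1 / K) * ((2 powr real i) powr (- 1 / K) / lam i)"
      using \<delta> K by (simp add: powr_mult powr_realpow)
    also have "(2 powr real i) powr (- 1 / K) / lam i = r powr real i"
      using K by (simp add: lam_def r_def powr_powr field_simps flip: powr_diff)
    also have "\<dots> = r ^ i" using r by (simp add: powr_realpow)
    finally show ?thesis .
  qed
  have "summable (\<lambda>i. prob (A i))"
    by (rule summable_comparison_test'[of "\<lambda>i. (\<delta> * K) powr (- 1 / K) * r ^ i" 0])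
      (use r bound in \<open>auto intro!: summable_mult summable_geometric\<close>)
  then have "AE \<omega> in M. \<forall>\<^sub>F i in sequentially. \<omega> \<in> space M - A i"
    by (intro borel_cantelli_AE1) (auto simp: emeasure_eq_measure)
  then show ?thesis
  proof eventually_elim
    case (elim \<omega>)
    then obtain i0 where i0: "\<And>i. i \<ge> i0 \<Longrightarrow> \<omega> \<in> space M - A i"
      by (auto simp: eventually_sequentially)
    show ?case
    proof (intro exI conjI)
      show "1 / (2 * K) > 0" using K by simp
      show "\<forall>\<^sub>F n in sequentially. L (H n \<omega>) \<ge> 1 / (2 * K) * ln (real n)"
      \<comment> \<open>Starting one block later forces \<open>i > i0\<close>, hence
        \<open>i \<ge> 1\<close> and \<open>Suc i \<le> 2 * i\<close>, which is used to compare
        \<open>i\<close> with \<open>ln j\<close>.\<close>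
      proof (rule eventually_sequentiallyI[of "2 ^ Suc i0"])
        fix j :: nat assume j: "2 ^ Suc i0 \<le> j"
        have "j \<ge> 1" using j by (metis one_le_numeral one_le_power order.trans)
        then obtain i where i: "2 ^ i \<le> j" "j < 2 ^ Suc i"
          using ex_power_ivl1[of 2 j] by auto
        have "(2::nat) ^ Suc i0 < 2 ^ Suc i" using i j by linarith
        then have ii: "i \<ge> i0" "i \<ge> 1" by (auto simp: power_strict_increasing_iff)
        have "\<omega> \<in> space M" "\<omega> \<notin> A i" using i0[OF ii(1)] by auto
        then have "Y (H j \<omega>) < lam i"
          using i unfolding A_def by force
        then have "- L (H j \<omega>) / 2 < - real i / (2 * K) * ln 2"
          by (simp add: Y_def lam_def powr_def)
        then have L: "L (H j \<omega>) \<ge> real i * ln 2 / K" by (simp add: field_simps)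
        have "real j \<le> real (2 ^ Suc i)"
          using i by (intro of_nat_mono) simp
        then have "ln (real j) \<le> ln (2 ^ Suc i)"
          using \<open>j \<ge> 1\<close> by (intro ln_mono) auto
        also have "\<dots> = real (Suc i) * ln 2" by (rule ln_realpow)
        also have "\<dots> \<le> (2 * real i) * ln 2" using ii by (intro mult_right_mono) auto
        finally have "1 / (2 * K) * ln (real j) \<le> 1 / (2 * K) * (2 * real i * ln 2)"
          using K by (intro mult_left_mono) auto
        also have "\<dots> = real i * ln 2 / K" by simp
        finally show "L (H j \<omega>) \<ge> 1 / (2 * K) * ln (real j)" using L by linarith
      qed
    qed
  qed
qed

end

section \<open>The learning process\<close>

lemma reported_eq_1_iff:
  "reported \<sigma> l s \<epsilon> v = 1 \<longleftrightarrow> (if s > thr \<sigma> l then flip_prob \<epsilon> s (thr \<sigma> l) \<le> v else v < flip_prob \<epsilon> s (thr \<sigma> l))"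
  by (auto simp: reported_def intended_def)

lemma measurable_reported [measurable]:
  "Measurable.pred (borel \<Otimes>\<^sub>M borel \<Otimes>\<^sub>M borel)
     (\<lambda>x. reported \<sigma> l (fst x) (fst (snd x)) (snd (snd x)) = 1)"
  unfolding reported_eq_1_iff flip_prob_def by measurable

lemma sets_reported:
  "{x. reported \<sigma> l (fst x) (fst (snd x)) (snd (snd x)) = 1} \<in> sets (borel \<Otimes>\<^sub>M borel \<Otimes>\<^sub>M borel)"
  using measurable_reported[of \<sigma> l] by (simp add: pred_def space_pair_measure)

lemma reported_cases: "reported \<sigma> l s \<epsilon> v = 1 \<or> reported \<sigma> l s \<epsilon> v = -1"
  by (auto simp: reported_def intended_def)

lemma uniform_lessThan:
  assumes "0 \<le> u" "u \<le> 1"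
  shows "measure (density lborel (indicator {0..1})) {..<u} = (u :: real)"
proof -
  have "emeasure (density lborel (indicator {0..1})) {..<u}
      = (\<integral>\<^sup>+ x. indicator {0..1} x * indicator {..<u} x \<partial>lborel)"
    by (rule emeasure_density) auto
  also have "\<dots> = (\<integral>\<^sup>+ x. indicator {0..<u} x \<partial>lborel)"
    using assms by (intro nn_integral_cong) (auto split: split_indicator)
  also have "\<dots> = ennreal u" using assms by simp
  finally show ?thesis using assms by (simp add: measure_def)
qed

text \<open>Report histories are lists with the most recent report first.\<close>
fun llr_of :: "real measure \<Rightarrow> real \<Rightarrow> bool list \<Rightarrow> real" where
  "llr_of G \<sigma> [] = 0"
| "llr_of G \<sigma> (b # bs) = llr_update G \<sigma> (llr_of G \<sigma> bs) (if b then 1 else -1)"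

fun reports :: "real measure \<Rightarrow> real \<Rightarrow> (nat \<Rightarrow> 'a \<Rightarrow> real) \<Rightarrow> (nat \<Rightarrow> 'a \<Rightarrow> real)
    \<Rightarrow> (nat \<Rightarrow> 'a \<Rightarrow> real) \<Rightarrow> nat \<Rightarrow> 'a \<Rightarrow> bool list" where
  "reports G \<sigma> S E V 0 \<omega> = []"
| "reports G \<sigma> S E V (Suc n) \<omega> =
     (reported \<sigma> (llr_of G \<sigma> (reports G \<sigma> S E V n \<omega>)) (S n \<omega>) (E n \<omega>) (V n \<omega>) = 1)
       # reports G \<sigma> S E V n \<omega>"

text \<open>Reports take two values only, so the real-valued recursion factors through a boolean
  history and fits the abstract process.\<close>

lemma public_llr_eq: "public_llr G \<sigma> S E V n \<omega> = llr_of G \<sigma> (reports G \<sigma> S E V n \<omega>)"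
proof (induction n)
  case (Suc n)
  then show ?case
    using reported_cases[of \<sigma> "public_llr G \<sigma> S E V n \<omega>" "S n \<omega>" "E n \<omega>" "V n \<omega>"] by auto
qed simp

text \<open>The primed families may live on another sample space: they will be coordinate
  projections, which exhibits the history as a function of the variables of earlier agents.\<close>

lemma reports_cong:
  assumes "\<And>i. i < n \<Longrightarrow> S i \<omega> = S' i \<omega>'" "\<And>i. i < n \<Longrightarrow> E i \<omega> = E' i \<omega>'" "\<And>i. i < n \<Longrightarrow> V i \<omega> = V' i \<omega>'"
  shows "reports G \<sigma> S E V n \<omega> = reports G \<sigma> S' E' V' n \<omega>'"
  using assms by (induction n) simp_all

text \<open>Measurability is asked only below \<open>n\<close> because projections from a product
  over a block are measurable only for its own coordinates. The induction uses that histories form a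
  countable type.\<close>

lemma measurable_reports:
  assumes "\<And>i. i < n \<Longrightarrow> S i \<in> borel_measurable M" "\<And>i. i < n \<Longrightarrow> E i \<in> borel_measurable M"
    "\<And>i. i < n \<Longrightarrow> V i \<in> borel_measurable M"
  shows "reports G \<sigma> S E V n \<in> measurable M (count_space UNIV)"
  using assms
proof (induction n)
  case 0
  have "reports G \<sigma> S E V 0 = (\<lambda>_. [])" by (rule ext) simp
  then show ?case by simp
next
  case (Suc n)
  have IH: "reports G \<sigma> S E V n \<in> measurable M (count_space UNIV)"
    by (rule Suc.IH) (use Suc.prems in auto)
  note [measurable] = Suc.prems[OF lessI]
  have "(\<lambda>\<omega>. (reported \<sigma> (llr_of G \<sigma> bs) (S n \<omega>) (E n \<omega>) (V n \<omega>) = 1) # bs) \<in> measurable M (count_space UNIV)" for bs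
  proof (rule measurable_compose[where g = "\<lambda>b. b # bs"])
    show "(\<lambda>\<omega>. reported \<sigma> (llr_of G \<sigma> bs) (S n \<omega>) (E n \<omega>) (V n \<omega>) = 1) \<in> measurable M (count_space UNIV)"
      unfolding reported_eq_1_iff flip_prob_def by measurable
  qed simp
  from measurable_compose_countable[OF this IH]
  have "(\<lambda>\<omega>. reports G \<sigma> S E V (Suc n) \<omega>) \<in> measurable M (count_space UNIV)"
    unfolding reports.simps .
  then show ?case .
qed

text \<open>Conditioning on state \<open>+1\<close> is built in: \<open>M\<close> is the conditional
  law, under which signals have mean 1. The sum type indexes all three families at once, so
  \<open>indep\<close> is joint independence across agents and kinds of variable.\<close>

locale sequential_learning = gaussian_budget G \<sigma> a + prob_space M
  for G \<sigma> a and M :: "'a measure" +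
  fixes S E V :: "nat \<Rightarrow> 'a \<Rightarrow> real"
  assumes indep: "indep_vars (\<lambda>_. borel)
      (\<lambda>i. case i of Inl n \<Rightarrow> S n | Inr (Inl n) \<Rightarrow> E n | Inr (Inr n) \<Rightarrow> V n) UNIV"
    and signal: "\<And>n. distributed M lborel (S n) (\<lambda>x. ennreal (normal_density 1 \<sigma> x))"
    and budget_measurable [measurable]: "\<And>n. E n \<in> borel_measurable M"
    and budget: "\<And>n. distr M borel (E n) = G"
    and uniform: "\<And>n. distributed M lborel (V n) (indicator {0..1})"
begin

abbreviation signal_law :: "real measure" where
  "signal_law \<equiv> density lborel (normal_density 1 \<sigma>)"

abbreviation uniform_law :: "real measure" where
  "uniform_law \<equiv> density lborel (indicator {0..1})"

abbreviation X :: "nat + nat + nat \<Rightarrow> 'a \<Rightarrow> real" where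
  "X \<equiv> \<lambda>i. case i of Inl n \<Rightarrow> S n | Inr (Inl n) \<Rightarrow> E n | Inr (Inr n) \<Rightarrow> V n"

lemma S_measurable [measurable]: "S n \<in> borel_measurable M"
  using distributed_measurable[OF signal] by simp

lemma V_measurable [measurable]: "V n \<in> borel_measurable M"
  using distributed_measurable[OF uniform] by simp

lemma distr_signal: "distr M borel (S n) = signal_law"
  unfolding distributed_distr_eq_density[OF signal[of n], symmetric] by (rule distr_cong) auto

lemma distr_uniform: "distr M borel (V n) = uniform_law"
  unfolding distributed_distr_eq_density[OF uniform[of n], symmetric] by (rule distr_cong) auto

text \<open>\<open>indep_var\<close> forces both variables into one type, so independence of functions of disjoint
  blocks is expressed by the product form of their joint law.\<close>
lemma distr_blocks:
  assumes "A \<inter> B = {}"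
    and f [measurable]: "f \<in> measurable (PiM A (\<lambda>_. borel)) N1"
    and g [measurable]: "g \<in> measurable (PiM B (\<lambda>_. borel)) N2"
  shows "distr M (N1 \<Otimes>\<^sub>M N2) (\<lambda>\<omega>. (f (\<lambda>i\<in>A. X i \<omega>), g (\<lambda>i\<in>B. X i \<omega>)))
    = distr M N1 (\<lambda>\<omega>. f (\<lambda>i\<in>A. X i \<omega>)) \<Otimes>\<^sub>M distr M N2 (\<lambda>\<omega>. g (\<lambda>i\<in>B. X i \<omega>))"
proof -
  let ?A = "PiM A (\<lambda>_. borel :: real measure)" and ?B = "PiM B (\<lambda>_. borel :: real measure)"
  let ?XA = "\<lambda>\<omega>. \<lambda>i\<in>A. X i \<omega>" and ?XB = "\<lambda>\<omega>. \<lambda>i\<in>B. X i \<omega>"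
  have ind: "indep_var ?A ?XA ?B ?XB"
    by (rule indep_var_restrict[OF indep assms(1)]) auto
  note [measurable] = indep_var_rv1[OF ind] indep_var_rv2[OF ind]
  interpret B: prob_space "distr M N2 (\<lambda>\<omega>. g (?XB \<omega>))"
    by (rule prob_space_distr) measurable
  have "distr M N1 (\<lambda>\<omega>. f (?XA \<omega>)) \<Otimes>\<^sub>M distr M N2 (\<lambda>\<omega>. g (?XB \<omega>))
      = distr (distr M ?A ?XA) N1 f \<Otimes>\<^sub>M distr (distr M ?B ?XB) N2 g"
    by (simp add: distr_distr comp_def)
  also have "\<dots> = distr (distr M ?A ?XA \<Otimes>\<^sub>M distr M ?B ?XB) (N1 \<Otimes>\<^sub>M N2) (\<lambda>(x, y). (f x, g y))"
    using B.sigma_finite_measure by (intro pair_measure_distr) (auto simp: distr_distr comp_def)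
  also have "distr M ?A ?XA \<Otimes>\<^sub>M distr M ?B ?XB = distr M (?A \<Otimes>\<^sub>M ?B) (\<lambda>\<omega>. (?XA \<omega>, ?XB \<omega>))"
    using ind by (simp add: indep_var_distribution_eq)
  also have "distr \<dots> (N1 \<Otimes>\<^sub>M N2) (\<lambda>(x, y). (f x, g y))
      = distr M (N1 \<Otimes>\<^sub>M N2) (\<lambda>\<omega>. (f (?XA \<omega>), g (?XB \<omega>)))"
    by (subst distr_distr) (auto simp: comp_def)
  finally show ?thesis ..
qed

abbreviation triple :: "nat \<Rightarrow> 'a \<Rightarrow> real \<times> real \<times> real" where
  "triple n \<omega> \<equiv> (S n \<omega>, E n \<omega>, V n \<omega>)"

lemma distr_triple:
  "distr M (borel \<Otimes>\<^sub>M borel \<Otimes>\<^sub>M borel) (triple n) = signal_law \<Otimes>\<^sub>M (G \<Otimes>\<^sub>M uniform_law)"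
proof -
  have EV: "distr M (borel \<Otimes>\<^sub>M borel) (\<lambda>\<omega>. (E n \<omega>, V n \<omega>)) = G \<Otimes>\<^sub>M uniform_law"
    using distr_blocks[of "{Inr (Inl n)}" "{Inr (Inr n)}" "\<lambda>x. x (Inr (Inl n))" borel
        "\<lambda>x. x (Inr (Inr n))" borel]
    by (simp add: budget distr_uniform)
  then show ?thesis
    using distr_blocks[of "{Inl n}" "{Inr (Inl n), Inr (Inr n)}" "\<lambda>x. x (Inl n)" borel
        "\<lambda>x. (x (Inr (Inl n)), x (Inr (Inr n)))" "borel \<Otimes>\<^sub>M borel"]
    by (simp add: distr_signal)
qed

text \<open>Integrating out the uniform variable first yields \<open>report_prob\<close>, then
  budget and signal yield \<open>prob_plus\<close>. Thus the probability in the public update for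
  state \<open>+1\<close> is the true one.\<close>

lemma prob_reported:
  "prob {\<omega> \<in> space M. reported \<sigma> l (S n \<omega>) (E n \<omega>) (V n \<omega>) = 1} = prob_plus G \<sigma> 1 l"
proof -
  interpret D: prob_space signal_law by (rule prob_space_normal_density[OF \<sigma>_pos])
  interpret U: prob_space uniform_law
    unfolding distr_uniform[of 0, symmetric] by (rule prob_space_distr) simp
  interpret GU: pair_prob_space G uniform_law ..
  interpret DGU: pair_prob_space signal_law "G \<Otimes>\<^sub>M uniform_law" ..
  define t where "t = thr \<sigma> l"
  define R :: "(real \<times> real \<times> real) set"
    where "R = {x. reported \<sigma> l (fst x) (fst (snd x)) (snd (snd x)) = 1}"
  have [measurable]: "R \<in> sets (borel \<Otimes>\<^sub>M borel \<Otimes>\<^sub>M borel)"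
    unfolding R_def by (rule sets_reported)
  have int: "integrable (signal_law \<Otimes>\<^sub>M (G \<Otimes>\<^sub>M uniform_law)) (indicator R :: _ \<Rightarrow> real)"
    by (rule DGU.integrable_const_bound[where B = 1]) (auto intro!: AE_I2 split: split_indicator)
  have int_s: "integrable (G \<Otimes>\<^sub>M uniform_law) (\<lambda>x. indicator R (s, x) :: real)" for s
    by (rule GU.integrable_const_bound[where B = 1]) (auto intro!: AE_I2 split: split_indicator)
  \<comment> \<open>A nonnegative budget keeps the flip probability in the unit interval, as the
    uniform law requires; almost every budget qualifies.\<close>
  have inner: "(\<integral>v. indicator R (s, \<epsilon>, v) \<partial>uniform_law) = report_prob \<epsilon> t s" if "0 \<le> \<epsilon>" for s \<epsilon>
  proof -
    have u: "measure uniform_law {..<flip_prob \<epsilon> s t} = flip_prob \<epsilon> s t"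
      using flip_prob_bounds[of \<epsilon> s t] that by (intro uniform_lessThan) auto
    show ?thesis
    proof (cases "s > t")
      case True
      then have "(\<integral>v. indicator R (s, \<epsilon>, v) \<partial>uniform_law)
          = (\<integral>v. indicator (space uniform_law - {..<flip_prob \<epsilon> s t}) v \<partial>uniform_law :: real)"
        by (intro Bochner_Integration.integral_cong)
          (auto simp: R_def reported_eq_1_iff t_def split: split_indicator)
      also have "\<dots> = 1 - flip_prob \<epsilon> s t"
        using U.prob_compl[of "{..<flip_prob \<epsilon> s t}"] u by simp
      finally show ?thesis using True by (simp add: report_prob_def)
    next
      case False
      then have "(\<integral>v. indicator R (s, \<epsilon>, v) \<partial>uniform_law)
          = (\<integral>v. indicator {..<flip_prob \<epsilon> s t} v \<partial>uniform_law :: real)"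
        by (intro Bochner_Integration.integral_cong)
          (auto simp: R_def reported_eq_1_iff t_def split: split_indicator)
      then show ?thesis using u False by (simp add: report_prob_def)
    qed
  qed
  have [measurable]: "(\<lambda>s. \<integral>\<epsilon>. report_prob \<epsilon> t s \<partial>G) \<in> borel_measurable borel"
    unfolding report_prob_def flip_prob_def by measurable
  have "prob {\<omega> \<in> space M. reported \<sigma> l (S n \<omega>) (E n \<omega>) (V n \<omega>) = 1} = prob (triple n -` R \<inter> space M)"
    by (intro arg_cong[where f = prob]) (auto simp: R_def)
  also have "\<dots> = measure (distr M (borel \<Otimes>\<^sub>M borel \<Otimes>\<^sub>M borel) (triple n)) R"
    by (subst measure_distr) auto
  also have "\<dots> = (\<integral>x. indicator R x \<partial>(signal_law \<Otimes>\<^sub>M (G \<Otimes>\<^sub>M uniform_law)))"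
    unfolding distr_triple by (simp add: space_pair_measure)
  also have "\<dots> = (\<integral>s. \<integral>\<epsilon>. \<integral>v. indicator R (s, \<epsilon>, v) \<partial>uniform_law \<partial>G \<partial>signal_law)"
    by (simp only: DGU.integral_fst'[OF int, symmetric] GU.integral_fst'[OF int_s, symmetric])
  also have "\<dots> = (\<integral>s. \<integral>\<epsilon>. report_prob \<epsilon> t s \<partial>G \<partial>signal_law)"
  proof (rule Bochner_Integration.integral_cong[OF refl], rule integral_cong_AE)
    fix s
    show "AE \<epsilon> in G. (\<integral>v. indicator R (s, \<epsilon>, v) \<partial>uniform_law) = report_prob \<epsilon> t s"
      using AE_budget by eventually_elim (auto intro: inner)
    show "(\<lambda>\<epsilon>. \<integral>v. indicator R (s, \<epsilon>, v) \<partial>uniform_law :: real) \<in> borel_measurable G" by measurable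
    show "(\<lambda>\<epsilon>. report_prob \<epsilon> t s) \<in> borel_measurable G"
      unfolding report_prob_def flip_prob_def by measurable
  qed
  also have "\<dots> = prob_plus G \<sigma> 1 l"
    by (subst integral_density) (simp_all, simp add: prob_plus_def report_prob_def t_def)
  finally show ?thesis .
qed

abbreviation H :: "nat \<Rightarrow> 'a \<Rightarrow> bool list" where
  "H \<equiv> reports G \<sigma> S E V"

abbreviation L :: "bool list \<Rightarrow> real" where
  "L \<equiv> llr_of G \<sigma>"

lemma H_measurable [measurable]: "H n \<in> measurable M (count_space UNIV)"
  by (rule measurable_reports) auto

text \<open>With the history fixed at \<open>xs\<close> the threshold is deterministic, so the event
  is a rectangle: the history depends on the variables of earlier agents (\<open>A\<close>), the
  report on those of agent \<open>n\<close> (\<open>B\<close>).\<close>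

lemma prob_report_step:
  "prob {\<omega> \<in> space M. H n \<omega> = xs \<and> reported \<sigma> (L xs) (S n \<omega>) (E n \<omega>) (V n \<omega>) = 1}
     = prob {\<omega> \<in> space M. H n \<omega> = xs} * prob_plus G \<sigma> 1 (L xs)"
proof -
  define A where "A = {i :: nat + nat + nat. case i of Inl j \<Rightarrow> j < n | Inr (Inl j) \<Rightarrow> j < n | Inr (Inr j) \<Rightarrow> j < n}"
  define B where "B = {Inl n, Inr (Inl n), Inr (Inr n) :: nat + nat + nat}"
  define f where "f = reports G \<sigma> (\<lambda>i x. x (Inl i)) (\<lambda>i x. x (Inr (Inl i))) (\<lambda>i x. x (Inr (Inr i))) n"
  define R where "R = {x. reported \<sigma> (L xs) (fst x) (fst (snd x)) (snd (snd x)) = 1}"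
  have R: "R \<in> sets (borel \<Otimes>\<^sub>M borel \<Otimes>\<^sub>M borel)"
    unfolding R_def by (rule sets_reported)
  let ?g = "\<lambda>x :: nat + nat + nat \<Rightarrow> real. (x (Inl n), x (Inr (Inl n)), x (Inr (Inr n)))"
  have f: "f \<in> measurable (PiM A (\<lambda>_. borel)) (count_space UNIV)"
    unfolding f_def by (rule measurable_reports) (auto simp: A_def)
  have g: "?g \<in> measurable (PiM B (\<lambda>_. borel)) (borel \<Otimes>\<^sub>M borel \<Otimes>\<^sub>M borel)"
    unfolding B_def by measurable
  have "A \<inter> B = {}" by (auto simp: A_def B_def)
  note blocks = distr_blocks[OF this f g]
  have fH: "f (\<lambda>i\<in>A. X i \<omega>) = H n \<omega>" for \<omega>
    unfolding f_def by (rule reports_cong) (auto simp: A_def)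
  have gT: "?g (\<lambda>i\<in>B. X i \<omega>) = triple n \<omega>" for \<omega>
    by (simp add: B_def)
  have joint: "distr M (count_space UNIV \<Otimes>\<^sub>M borel \<Otimes>\<^sub>M borel \<Otimes>\<^sub>M borel) (\<lambda>\<omega>. (H n \<omega>, triple n \<omega>))
      = distr M (count_space UNIV) (H n) \<Otimes>\<^sub>M distr M (borel \<Otimes>\<^sub>M borel \<Otimes>\<^sub>M borel) (triple n)"
    using blocks unfolding fH gT .
  interpret T: prob_space "distr M (borel \<Otimes>\<^sub>M borel \<Otimes>\<^sub>M borel) (triple n)"
    by (rule prob_space_distr) measurable
  have "prob {\<omega> \<in> space M. H n \<omega> = xs \<and> reported \<sigma> (L xs) (S n \<omega>) (E n \<omega>) (V n \<omega>) = 1}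
      = prob ((\<lambda>\<omega>. (H n \<omega>, triple n \<omega>)) -` ({xs} \<times> R) \<inter> space M)"
    by (intro arg_cong[where f = prob]) (auto simp: R_def)
  also have "\<dots> = measure (distr M (count_space UNIV) (H n)
      \<Otimes>\<^sub>M distr M (borel \<Otimes>\<^sub>M borel \<Otimes>\<^sub>M borel) (triple n)) ({xs} \<times> R)"
    unfolding joint[symmetric] using R by (subst measure_distr) auto
  also have "\<dots> = measure (distr M (count_space UNIV) (H n)) {xs}
      * measure (distr M (borel \<Otimes>\<^sub>M borel \<Otimes>\<^sub>M borel) (triple n)) R"
    unfolding measure_def using R by (subst T.emeasure_pair_measure_Times) (auto simp: enn2real_mult)
  also have "\<dots> = prob (H n -` {xs} \<inter> space M) * prob (triple n -` R \<inter> space M)"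
    using R by (simp add: measure_distr)
  also have "prob (triple n -` R \<inter> space M) = prob_plus G \<sigma> 1 (L xs)"
    unfolding prob_reported[of "L xs" n, symmetric]
    by (intro arg_cong[where f = prob]) (auto simp: R_def)
  also have "H n -` {xs} \<inter> space M = {\<omega> \<in> space M. H n \<omega> = xs}" by auto
  finally show ?thesis .
qed

lemma length_reports: "length (H n \<omega>) = n"
  by (induction n) auto

text \<open>Splitting over the finitely many histories of length \<open>n\<close> replaces
  conditioning by sums. On each, \<open>F\<close> at the next time is its value after a
  \<open>False\<close> report plus a jump on the event \<open>B xs\<close>, whose probability
  factorises.\<close>

lemma one_step:
  fixes F :: "bool list \<Rightarrow> real"
  shows "expectation (\<lambda>\<omega>. F (H (Suc n) \<omega>))
    = expectation (\<lambda>\<omega>. prob_plus G \<sigma> 1 (L (H n \<omega>)) * F (True # H n \<omega>)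
        + (1 - prob_plus G \<sigma> 1 (L (H n \<omega>))) * F (False # H n \<omega>))"
proof -
  define A where "A xs = {\<omega> \<in> space M. H n \<omega> = xs}" for xs
  define B where "B xs = {\<omega> \<in> space M. H n \<omega> = xs \<and> reported \<sigma> (L xs) (S n \<omega>) (E n \<omega>) (V n \<omega>) = 1}" for xs
  define Ln where "Ln = {xs :: bool list. length xs = n}"
  have fin: "finite Ln"
    using finite_lists_length_eq[of "UNIV :: bool set" n] by (simp add: Ln_def)
  have [measurable]: "A xs \<in> sets M" "B xs \<in> sets M" for xs
    unfolding A_def B_def reported_eq_1_iff flip_prob_def by measurable
  have ints: "integrable M (indicator (A xs) :: _ \<Rightarrow> real)" "integrable M (indicator (B xs) :: _ \<Rightarrow> real)" for xs
    by (auto intro!: integrable_real_indicator simp: emeasure_eq_measure)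
  have expand: "g (H n \<omega>) = (\<Sum>xs\<in>Ln. g xs * indicator (A xs) \<omega>)" if "\<omega> \<in> space M" for g :: "bool list \<Rightarrow> real" and \<omega>
  proof -
    have "(\<Sum>xs\<in>Ln. g xs * indicator (A xs) \<omega>) = (\<Sum>xs\<in>Ln. if xs = H n \<omega> then g xs else 0)"
      using that by (intro sum.cong) (auto simp: A_def)
    also have "\<dots> = g (H n \<omega>)" using fin by (simp add: sum.delta Ln_def length_reports)
    finally show ?thesis ..
  qed
  have AB: "prob (B xs) = prob (A xs) * prob_plus G \<sigma> 1 (L xs)" for xs
    unfolding A_def B_def by (rule prob_report_step)
  have "expectation (\<lambda>\<omega>. F (H (Suc n) \<omega>))
      = expectation (\<lambda>\<omega>. \<Sum>xs\<in>Ln. F (False # xs) * indicator (A xs) \<omega>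
          + (F (True # xs) - F (False # xs)) * indicator (B xs) \<omega>)"
  proof (rule Bochner_Integration.integral_cong)
    fix \<omega> assume \<omega>: "\<omega> \<in> space M"
    let ?b = "\<lambda>xs. reported \<sigma> (L xs) (S n \<omega>) (E n \<omega>) (V n \<omega>) = 1"
    have "F (H (Suc n) \<omega>) = (\<Sum>xs\<in>Ln. F (?b xs # xs) * indicator (A xs) \<omega>)"
      using expand[OF \<omega>, of "\<lambda>xs. F (?b xs # xs)"] by simp
    also have "\<dots> = (\<Sum>xs\<in>Ln. F (False # xs) * indicator (A xs) \<omega>
          + (F (True # xs) - F (False # xs)) * indicator (B xs) \<omega>)"
      by (intro sum.cong) (auto simp: A_def B_def split: split_indicator)
    finally show "F (H (Suc n) \<omega>) = \<dots>" .
  qed simp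
  also have "\<dots> = (\<Sum>xs\<in>Ln. F (False # xs) * prob (A xs) + (F (True # xs) - F (False # xs)) * prob (B xs))"
    using ints by (simp add: Bochner_Integration.integral_sum)
  also have "\<dots> = (\<Sum>xs\<in>Ln. (prob_plus G \<sigma> 1 (L xs) * F (True # xs)
        + (1 - prob_plus G \<sigma> 1 (L xs)) * F (False # xs)) * prob (A xs))"
    unfolding AB by (intro sum.cong) (auto simp: algebra_simps)
  also have "\<dots> = expectation (\<lambda>\<omega>. \<Sum>xs\<in>Ln. (prob_plus G \<sigma> 1 (L xs) * F (True # xs)
        + (1 - prob_plus G \<sigma> 1 (L xs)) * F (False # xs)) * indicator (A xs) \<omega>)"
    using ints by (simp add: Bochner_Integration.integral_sum)
  also have "\<dots> = expectation (\<lambda>\<omega>. prob_plus G \<sigma> 1 (L (H n \<omega>)) * F (True # H n \<omega>)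
        + (1 - prob_plus G \<sigma> 1 (L (H n \<omega>))) * F (False # H n \<omega>))"
    by (intro Bochner_Integration.integral_cong refl
        expand[of _ "\<lambda>xs. prob_plus G \<sigma> 1 (L xs) * F (True # xs)
          + (1 - prob_plus G \<sigma> 1 (L xs)) * F (False # xs)", symmetric])
  finally show ?thesis .
qed

section \<open>The two growth rates of the public log-likelihood ratio\<close>

lemma llr_log_growth:
  "AE \<omega> in M. \<exists>c>0. \<forall>\<^sub>F n in sequentially. public_llr G \<sigma> S E V n \<omega> \<ge> c * ln (real n)"
proof -
  obtain c where c: "c > 0"
    "\<And>l. prob_plus G \<sigma> 1 l - prob_plus G \<sigma> (-1) l \<ge> c * exp (- (a * \<sigma>\<^sup>2 / 2) * \<bar>l\<bar>)"
    using prob_plus_diff_ge by blast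
  interpret llr_process M H L "prob_plus G \<sigma> 1" "prob_plus G \<sigma> (-1)" c "a * \<sigma>\<^sup>2 / 2"
  proof
    show "expectation (\<lambda>\<omega>. F (H (Suc n) \<omega>))
      = expectation (\<lambda>\<omega>. prob_plus G \<sigma> 1 (L (H n \<omega>)) * F (True # H n \<omega>)
          + (1 - prob_plus G \<sigma> 1 (L (H n \<omega>))) * F (False # H n \<omega>))" for n and F :: "bool list \<Rightarrow> real"
      by (rule one_step)
  qed (use c a_pos \<sigma>_pos in \<open>simp_all add: prob_plus_bounds llr_update_def prob_action_def\<close>)
  show ?thesis using log_growth by (simp add: public_llr_eq)
qed

lemma llr_sqrt_growth:
  obtains K where "\<And>n \<omega>. public_llr G \<sigma> S E V n \<omega> \<le> K * sqrt (real n)"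
proof -
  let ?r = "\<lambda>l. ln (prob_plus G \<sigma> 1 l / prob_plus G \<sigma> (-1) l)"
  obtain C1 where C1: "C1 > 0" "\<And>l. l \<ge> 1 \<Longrightarrow> ?r l \<le> C1 / l"
    using ln_prob_plus_ratio_le_inverse by blast
  obtain c where c: "c > 0"
    "\<And>l. prob_plus G \<sigma> 1 l - prob_plus G \<sigma> (-1) l \<ge> c * exp (- (a * \<sigma>\<^sup>2 / 2) * \<bar>l\<bar>)"
    using prob_plus_diff_ge by blast
  have mono: "prob_plus G \<sigma> (-1) l < prob_plus G \<sigma> 1 l" for l
    using c(2)[of l] mult_pos_pos[OF c(1) exp_gt_zero[of "- (a * \<sigma>\<^sup>2 / 2) * \<bar>l\<bar>"]] by linarith
  define C where "C = max C1 (ln (2 * exp (2 * a)))"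
  \<comment> \<open>As \<open>+1\<close> is more likely in state \<open>+1\<close>, a report
    \<open>-1\<close> cannot raise \<open>l\<close>, and the increment of a report \<open>+1\<close>
    bounds both.\<close>
  have step: "llr_update G \<sigma> l x \<le> l + ?r l" if "x = 1 \<or> x = -1" for l x
  proof -
    have "ln ((1 - prob_plus G \<sigma> 1 l) / (1 - prob_plus G \<sigma> (-1) l)) \<le> ?r l"
    proof (rule ln_mono)
      have "(1 - prob_plus G \<sigma> 1 l) / (1 - prob_plus G \<sigma> (-1) l) \<le> 1"
        "1 \<le> prob_plus G \<sigma> 1 l / prob_plus G \<sigma> (-1) l"
        using mono[of l] prob_plus_bounds[of 1 l] prob_plus_bounds[of "-1" l] by simp_all
      then show "(1 - prob_plus G \<sigma> 1 l) / (1 - prob_plus G \<sigma> (-1) l)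
          \<le> prob_plus G \<sigma> 1 l / prob_plus G \<sigma> (-1) l"
        by linarith
    qed (use prob_plus_bounds[of 1 l] prob_plus_bounds[of "-1" l] in simp)
    then show ?thesis using that by (auto simp: llr_update_def prob_action_def)
  qed
  show ?thesis
  proof
    fix n \<omega>
    show "public_llr G \<sigma> S E V n \<omega> \<le> (1 + C) * sqrt (real n)"
    proof (rule sqrt_growth)
      show "C \<ge> 0" using C1(1) by (simp add: C_def)
      fix n
      let ?l = "public_llr G \<sigma> S E V n \<omega>"
      have *: "public_llr G \<sigma> S E V (Suc n) \<omega> \<le> ?l + ?r ?l"
        using reported_cases by (simp add: step)
      show "public_llr G \<sigma> S E V (Suc n) \<omega> \<le> ?l + C"
        using * ln_prob_plus_ratio_le[of ?l] unfolding C_def by linarith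
      assume l: "?l \<ge> 1"
      then have "C1 / ?l \<le> C / ?l" by (intro divide_right_mono) (auto simp: C_def)
      then show "public_llr G \<sigma> S E V (Suc n) \<omega> \<le> ?l + C / ?l"
        using * C1(2)[OF l] by linarith
    qed simp
  qed
qed

end

theorem theorem11:
  fixes M :: "'a measure" and G :: "real measure" and \<sigma> a :: real
    and S E V :: "nat \<Rightarrow> 'a \<Rightarrow> real"
  assumes "prob_space M"
    and "\<sigma> > 0" and "a > 0"
    and "prob_space G" and "sets G = sets borel"
    and "emeasure G {0..a} = 1" and "emeasure G {0} = 0"
    and "prob_space.indep_vars M (\<lambda>_. borel)
           (\<lambda>i. case i of Inl n \<Rightarrow> S n | Inr (Inl n) \<Rightarrow> E n | Inr (Inr n) \<Rightarrow> V n) UNIV"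
    and "\<And>n. distributed M lborel (S n) (\<lambda>x. ennreal (normal_density 1 \<sigma> x))"
    and "\<And>n. E n \<in> borel_measurable M" and "\<And>n. distr M borel (E n) = G"
    and "\<And>n. distributed M lborel (V n) (indicator {0..1})"
  shows "AE \<omega> in M.
           (\<lambda>n. public_llr G \<sigma> S E V n \<omega>) \<in> O(\<lambda>n. sqrt (real n)) \<and>
           (\<exists>c>0. \<forall>\<^sub>F n in sequentially. public_llr G \<sigma> S E V n \<omega> \<ge> c * ln (real n))"
proof -
  interpret sequential_learning G \<sigma> a M S E V
    using assms by (intro sequential_learning.intro gaussian_budget.intro
      gaussian_budget_axioms.intro sequential_learning_axioms.intro)
  obtain K where K: "\<And>n \<omega>. public_llr G \<sigma> S E V n \<omega> \<le> K * sqrt (real n)"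
    using llr_sqrt_growth by blast
  from llr_log_growth show ?thesis
  proof eventually_elim
    case (elim \<omega>)
    then obtain c where c: "c > 0" "\<forall>\<^sub>F n in sequentially. public_llr G \<sigma> S E V n \<omega> \<ge> c * ln (real n)"
      by blast
    \<comment> \<open>Order bounds concern absolute values; the logarithmic lower bound makes the
      process eventually nonnegative, so the one-sided upper bound suffices.\<close>
    have "(\<lambda>n. public_llr G \<sigma> S E V n \<omega>) \<in> O(\<lambda>n. sqrt (real n))"
    proof (rule bigoI)
      show "\<forall>\<^sub>F n in sequentially. norm (public_llr G \<sigma> S E V n \<omega>) \<le> K * norm (sqrt (real n))"
        using c(2) eventually_ge_at_top[of 1]
      proof eventually_elim
        case (elim n)
        have "0 \<le> c * ln (real n)" using elim c(1) by (intro mult_nonneg_nonneg) auto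
        then show ?case using elim K[of n \<omega>] by simp
      qed
    qed
    then show ?case using elim by blast
  qed
qed

end
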